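(* Let $\lambda$ and $\mu$ be partitions with $\ell(\lambda')\le n$. Then \[ \widetilde{g}_{\lambda/\mu}(x;t) = \det \left( e_{\lambda'_i-\mu'_j-i+j} (x_1,x_2,\dots,t_{\mu'_j+1},t_{\mu'_j+2},\dots,t_{\lambda'_i-1}) \right)_{1\le i,j\le n}, \] where, if $\mu'_j+1>\lambda'_i-1$, the $(i,j)$ entry is defined to be $e_{\lambda'_i-\mu'_j-i+j}(x_1,x_2,\dots)$.
   Context: A partition $\lambda=(\lambda_1,\lambda_2,\dots)$ is a weakly decreasing sequence of positive integers (with $\lambda_i=0$ for $i>\ell(\lambda)$, where the length $\ell(\lambda)$ is the number of parts), identified with its Young diagram $\{(i,j): 1\le i\le \ell(\lambda),\ 1\le j\le\lambda_i\}$ ($i$ is the row index, $j$ the column index). The conjugate $\lambda'$ is the partition with diagram $\{(i,j):(j,i)\in\lambda\}$, and $\mu\subseteq\lambda$ means $\mu_i\le\lambda_i$ for all $i$; in that case $\lambda/\mu$ is the set difference of the diagrams. A reverse plane partition (RPP) of shape $\lambda/\mu$ is a map $R:\lambda/\mu\to\{1,2,\dots\}$ whose entries weakly increase along rows and down columns: $R(i,j)\le R(i,j+1)$ and $R(i,j)\le R(i+1,j)$ whenever these values are defined. Let $\mathrm{RPP}(\lambda/\mu)$ be the set of these. The weight of $R$ is $\mathrm{wt}(R)=\prod_{i\ge1}x_i^{a_i(R)}t_i^{b_i(R)}$, where $a_i(R)$ is the number of columns containing an $i$ and $b_i(R)$ is the number of cells $(i,j)$ in row $i$ such that $(i,j)$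 and $(i+1,j)$ both belong to $\lambda/\mu$ and $R(i,j)=R(i+1,j)$. For sequences of variables $x=(x_1,x_2,\dots)$ and $t=(t_1,t_2,\dots)$, the refined dual stable Grothendieck polynomial is $\widetilde g_{\lambda/\mu}(x;t)=\sum_{R\in\mathrm{RPP}(\lambda/\mu)}\mathrm{wt}(R)$, and $\widetilde g_{\lambda/\mu}(x;t)=0$ by definition if $\mu\not\subseteq\lambda$. $e_k(z_1,z_2,\dots)=\sum_{i_1<i_2<\dots<i_k}z_{i_1}z_{i_2}\cdots z_{i_k}$ is the $k$th elementary symmetric function, with $e_0=1$ and $e_k=0$ for $k<0$; in the determinant it is evaluated on the list consisting of all the $x$ variables and the indicated finite list of $t$ variables.
   Formalization: The condition ℓ(μ′) ≤ n is added; it is automatic when μ ⊆ λ, but without it the claim fails, e.g. λ=(1), μ=(2), n=1, where the left side is 0 by definition and the determinant is e_0 = 1. *)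

theory Defs
  imports
    "Jordan_Normal_Form.Determinant"
    "HOL-Library.Multiset"
    "HOL-Library.FuncSet"
    "HOL-Library.Groups_Big_Fun"
begin

section \<open>Formal power series in an arbitrary set of commuting variables\<close>

text \<open>A monomial in variables from \<open>'v\<close> is a finite multiset of variables; a formal power series
  assigns a coefficient to every monomial.\<close>

typedef ('v, 'a) mps = "UNIV :: ('v multiset \<Rightarrow> 'a) set"
  morphisms mps_nth Abs_mps
  by simp

lemma mps_nth_Abs [simp]: "mps_nth (Abs_mps f) = f"
  by (simp add: Abs_mps_inverse)

lemma mps_eqI: "(\<And>m. mps_nth f m = mps_nth g m) \<Longrightarrow> f = g"
  by (metis mps_nth_inject ext)

lemma finite_submultisets: "finite {A. A \<subseteq># M}"
proof (induction M)
  case empty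
  show ?case by simp
next
  case (add x M)
  have "{A. A \<subseteq># add_mset x M} \<subseteq> {A. A \<subseteq># M} \<union> add_mset x ` {A. A \<subseteq># M}"
  proof
    fix A assume A: "A \<in> {A. A \<subseteq># add_mset x M}"
    show "A \<in> {A. A \<subseteq># M} \<union> add_mset x ` {A. A \<subseteq># M}"
    proof (cases "x \<in># A")
      case True
      then obtain B where "A = add_mset x B" by (metis insert_DiffM)
      with A show ?thesis by auto
    next
      case False
      have "A \<subseteq># M"
      proof (rule mset_subset_eqI)
        fix y
        have "count A y \<le> count (add_mset x M) y"
          using A unfolding mem_Collect_eq by (rule mset_subset_eq_count)
        with False show "count A y \<le> count M y"
          by (cases "y = x") (simp_all add: not_in_iff)
      qed
      then show ?thesis by simp
    qed
  qed
  with add show ?case by (meson finite_UnI finite_imageI finite_subset)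
qed

instantiation mps :: (type, zero) zero
begin
definition "0 = Abs_mps (\<lambda>_. 0)"
instance ..
end

instantiation mps :: (type, zero_neq_one) one
begin
definition "1 = Abs_mps (\<lambda>m. if m = {#} then 1 else 0)"
instance ..
end

instantiation mps :: (type, plus) plus
begin
definition "f + g = Abs_mps (\<lambda>m. mps_nth f m + mps_nth g m)"
instance ..
end

instantiation mps :: (type, minus) minus
begin
definition "f - g = Abs_mps (\<lambda>m. mps_nth f m - mps_nth g m)"
instance ..
end

instantiation mps :: (type, uminus) uminus
begin
definition "- f = Abs_mps (\<lambda>m. - mps_nth f m)"
instance ..
end

instantiation mps :: (type, "{comm_monoid_add, times}") times
begin
definition "f * g = Abs_mps (\<lambda>m. \<Sum>A | A \<subseteq># m. mps_nth f A * mps_nth g (m - A))"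
instance ..
end

lemma mps_nth_simps [simp]:
  "mps_nth 0 m = 0"
  "mps_nth 1 m = (if m = {#} then 1 else 0)"
  "mps_nth (f + g) m = mps_nth f m + mps_nth g m"
  "mps_nth (f' - g') m = mps_nth f' m - mps_nth g' m"
  "mps_nth (- h) m = - mps_nth h m"
  by (simp_all add: zero_mps_def one_mps_def plus_mps_def minus_mps_def uminus_mps_def)

lemma mps_nth_times:
  "mps_nth (f * g) m = (\<Sum>A | A \<subseteq># m. mps_nth f A * mps_nth g (m - A))"
  by (simp add: times_mps_def)

instance mps :: (type, comm_ring_1) comm_ring_1
proof
  fix f g h :: "('a, 'b) mps"
  show "f + g + h = f + (g + h)" "f + g = g + f" "0 + f = f" "- f + f = 0" "f - g = f + - g"
    by (auto intro!: mps_eqI simp: algebra_simps)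
  show "(0 :: ('a, 'b) mps) \<noteq> 1"
    by (metis mps_nth_simps(1,2) zero_neq_one)
  show "(f + g) * h = f * h + g * h"
    by (auto intro!: mps_eqI simp: mps_nth_times algebra_simps sum.distrib)
  show "1 * f = f"
  proof (rule mps_eqI)
    fix m
    have "mps_nth (1 * f) m = (\<Sum>A \<in> {A. A \<subseteq># m}. if A = {#} then mps_nth f m else 0)"
      unfolding mps_nth_times by (intro sum.cong) auto
    then show "mps_nth (1 * f) m = mps_nth f m"
      by (simp add: finite_submultisets)
  qed
  show "f * g = g * f"
  proof (rule mps_eqI)
    fix m
    show "mps_nth (f * g) m = mps_nth (g * f) m"
      unfolding mps_nth_times
      by (rule sum.reindex_bij_witness[where i = "\<lambda>A. m - A" and j = "\<lambda>A. m - A"])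
        (auto simp: subset_mset.diff_diff_right mult.commute)
  qed
  show "f * g * h = f * (g * h)"
  proof (rule mps_eqI)
    fix m
    have "mps_nth (f * g * h) m =
        (\<Sum>(A, B) \<in> (SIGMA A:{A. A \<subseteq># m}. {B. B \<subseteq># A}).
           mps_nth f B * mps_nth g (A - B) * mps_nth h (m - A))"
      by (simp add: mps_nth_times sum_distrib_right finite_submultisets sum.Sigma)
    also have "\<dots> =
        (\<Sum>(B, C) \<in> (SIGMA B:{B. B \<subseteq># m}. {C. C \<subseteq># m - B}).
           mps_nth f B * (mps_nth g C * mps_nth h (m - B - C)))"
    proof (rule sum.reindex_bij_witness[where i = "\<lambda>(B, C). (B + C, B)" and j = "\<lambda>(A, B). (B, A - B)"],
        goal_cases)
      case (1 a)
      then show ?case by auto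
    next
      case (2 a)
      then show ?case by (auto simp: subseteq_mset_def intro: order_trans intro!: diff_le_mono)
    next
      case (3 b)
      then show ?case by auto
    next
      case (4 b)
      then show ?case
        by (auto simp: subset_mset.le_diff_conv2 add.commute)
    next
      case (5 a)
      then show ?case
        by (auto simp: mult.assoc)
    qed
    also have "\<dots> = mps_nth (f * (g * h)) m"
      by (simp add: mps_nth_times sum_distrib_left finite_submultisets sum.Sigma)
    finally show "mps_nth (f * g * h) m = mps_nth (f * (g * h)) m" .
  qed
qed

definition mps_monom :: "'v multiset \<Rightarrow> ('v, 'a :: zero_neq_one) mps" where
  "mps_monom M = Abs_mps (\<lambda>m. if m = M then 1 else 0)"

definition mps_var :: "'v \<Rightarrow> ('v, 'a :: zero_neq_one) mps" where
  "mps_var v = mps_monom {#v#}"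

text \<open>Possibly infinite sums are taken coefficientwise. They are meaningful for summable families,
  that is, if every coefficient receives only finitely many nonzero contributions; the two families
  summed below are shown to be summable.\<close>

definition mps_summable :: "('b \<Rightarrow> ('v, 'a :: comm_monoid_add) mps) \<Rightarrow> 'b set \<Rightarrow> bool" where
  "mps_summable f I \<longleftrightarrow> (\<forall>m. finite {i \<in> I. mps_nth (f i) m \<noteq> 0})"

definition mps_sum :: "('b \<Rightarrow> ('v, 'a :: comm_monoid_add) mps) \<Rightarrow> 'b set \<Rightarrow> ('v, 'a) mps" where
  "mps_sum f I = Abs_mps (\<lambda>m. \<Sum>i | i \<in> I \<and> mps_nth (f i) m \<noteq> 0. mps_nth (f i) m)"

lemma mps_nth_monom [simp]: "mps_nth (mps_monom M) m = (if m = M then 1 else 0)"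
  by (simp add: mps_monom_def)

lemma mps_monom_empty [simp]: "mps_monom {#} = 1"
  by (rule mps_eqI) simp

lemma mps_monom_eq_1_iff [simp]: "mps_monom M = 1 \<longleftrightarrow> M = {#}"
  by (metis mps_monom_empty mps_nth_monom zero_neq_one)

lemma mps_monom_add:
  "mps_monom (M + N) = (mps_monom M * mps_monom N :: ('v, 'a :: comm_ring_1) mps)"
proof (rule mps_eqI)
  fix m
  have "mps_nth (mps_monom M * mps_monom N :: ('v, 'a) mps) m =
      (\<Sum>A \<in> {A. A \<subseteq># m}. if A = M then (if m - M = N then 1 else 0) else 0)"
    unfolding mps_nth_times by (intro sum.cong) auto
  also have "\<dots> = (if M \<subseteq># m \<and> m - M = N then 1 else 0)"
    by (simp add: finite_submultisets)
  also have "M \<subseteq># m \<and> m - M = N \<longleftrightarrow> m = M + N"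
    by auto
  finally show "mps_nth (mps_monom (M + N)) m = mps_nth (mps_monom M * mps_monom N :: ('v, 'a) mps) m"
    by simp
qed

lemma mps_monom_sum:
  "mps_monom (\<Sum>i\<in>S. M i) = (\<Prod>i\<in>S. mps_monom (M i) :: ('v, 'a :: comm_ring_1) mps)"
  by (induction S rule: infinite_finite_induct) (simp_all add: mps_monom_add)

lemma mps_var_power:
  "mps_var v ^ k = (mps_monom (replicate_mset k v) :: ('v, 'a :: comm_ring_1) mps)"
  by (induction k) (simp_all add: mps_var_def mps_monom_add [symmetric])

section \<open>Partitions and Young diagrams\<close>

definition is_partition :: "nat list \<Rightarrow> bool" where
  "is_partition lam \<longleftrightarrow> sorted_wrt (\<ge>) lam \<and> (\<forall>p \<in> set lam. p > 0)"

text \<open>Parts are indexed from 1 and padded with zeros.\<close>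

definition part :: "nat list \<Rightarrow> nat \<Rightarrow> nat" where
  "part lam i = (if 1 \<le> i \<and> i \<le> length lam then lam ! (i - 1) else 0)"

definition diagram :: "nat list \<Rightarrow> (nat \<times> nat) set" where
  "diagram lam = {(i, j). 1 \<le> i \<and> i \<le> length lam \<and> 1 \<le> j \<and> j \<le> part lam i}"

definition conj_partition :: "nat list \<Rightarrow> nat list" where
  "conj_partition lam = (THE \<nu>. is_partition \<nu> \<and> diagram \<nu> = {(i, j). (j, i) \<in> diagram lam})"

definition contained :: "nat list \<Rightarrow> nat list \<Rightarrow> bool" where
  "contained mu lam \<longleftrightarrow> (\<forall>i \<ge> 1. part mu i \<le> part lam i)"

definition skew_diagram :: "nat list \<Rightarrow> nat list \<Rightarrow> (nat \<times> nat) set" where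
  "skew_diagram lam mu = diagram lam - diagram mu"

lemma finite_diagram: "finite (diagram lam)"
proof (rule finite_subset)
  show "diagram lam \<subseteq> (SIGMA i:{1..length lam}. {1..part lam i})"
    by (auto simp: diagram_def)
qed auto

lemma part_antimono:
  assumes "is_partition lam" "1 \<le> i" "i \<le> k"
  shows "part lam k \<le> part lam i"
proof (cases "k \<le> length lam \<and> i < k")
  case True
  then have "lam ! (i - 1) \<ge> lam ! (k - 1)"
    using assms unfolding is_partition_def by (intro sorted_wrt_nth_less[of "(\<ge>)"]) auto
  with True assms show ?thesis by (auto simp: part_def)
next
  case False
  with assms show ?thesis by (auto simp: part_def)
qed

lemma part_pos: "is_partition lam \<Longrightarrow> 1 \<le> i \<Longrightarrow> i \<le> length lam \<Longrightarrow> 1 \<le> part lam i"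
  by (auto simp: part_def is_partition_def Suc_le_eq)

lemma diagram_inj:
  assumes "is_partition lam" "is_partition \<nu>" "diagram lam = diagram \<nu>"
  shows "lam = \<nu>"
proof -
  have len: "length \<alpha> \<le> length \<beta>"
    if "is_partition \<alpha>" "diagram \<alpha> = diagram \<beta>" for \<alpha> \<beta>
  proof (cases "length \<alpha> = 0")
    case False
    then have "(length \<alpha>, 1) \<in> diagram \<alpha>"
      using part_pos[OF that(1), of "length \<alpha>"] by (auto simp: diagram_def Suc_le_eq)
    with that(2) show ?thesis by (auto simp: diagram_def)
  qed simp
  have part_le: "part \<alpha> i \<le> part \<beta> i" if "is_partition \<alpha>" "diagram \<alpha> = diagram \<beta>" for \<alpha> \<beta> i
  proof (cases "1 \<le> i \<and> i \<le> length \<alpha>")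
    case True
    then have "(i, part \<alpha> i) \<in> diagram \<alpha>"
      using part_pos[OF that(1), of i] by (auto simp: diagram_def)
    with that(2) show ?thesis by (auto simp: diagram_def)
  qed (auto simp: part_def)
  have l: "length lam = length \<nu>"
    using len[of lam \<nu>] len[of \<nu> lam] assms by simp
  show ?thesis
  proof (rule nth_equalityI[OF l])
    fix i assume "i < length lam"
    moreover have "part lam (Suc i) = part \<nu> (Suc i)"
      using part_le[of lam \<nu> "Suc i"] part_le[of \<nu> lam "Suc i"] assms by simp
    ultimately show "lam ! i = \<nu> ! i" using l by (simp add: part_def)
  qed
qed

lemma down_closed_eq_interval:
  assumes "finite S" "0 \<notin> S" "\<And>i k. k \<in> S \<Longrightarrow> 1 \<le> i \<Longrightarrow> i \<le> k \<Longrightarrow> i \<in> S"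
  shows "S = {1..card S}"
proof (cases "S = {}")
  case False
  have "S = {1..Max S}"
  proof
    show "S \<subseteq> {1..Max S}"
    proof
      fix x assume "x \<in> S"
      moreover from this have "x \<noteq> 0" using assms(2) by metis
      ultimately show "x \<in> {1..Max S}" using assms(1) by simp
    qed
    show "{1..Max S} \<subseteq> S"
      using assms(3)[OF Max_in[OF assms(1) False]] by auto
  qed
  moreover from this have "card S = Max S"
    by (metis card_atLeastAtMost diff_Suc_1)
  ultimately show ?thesis by simp
qed simp

lemma conj_partition_ex:
  assumes "is_partition lam"
  shows "\<exists>\<nu>. is_partition \<nu> \<and> diagram \<nu> = {(i, j). (j, i) \<in> diagram lam}"
proof -
  define col where "col j = {i. (i, j) \<in> diagram lam}" for j
  have fin: "finite (col j)" for j
    by (rule finite_surj[OF finite_diagram[of lam], of _ fst]) (force simp: col_def)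
  have col: "col j = {1..card (col j)}" for j
  proof (rule down_closed_eq_interval[OF fin])
    show "0 \<notin> col j" by (auto simp: col_def diagram_def)
    show "i \<in> col j" if "k \<in> col j" "1 \<le> i" "i \<le> k" for i k
      using that part_antimono[OF assms that(2,3)] by (auto simp: col_def diagram_def)
  qed
  have ne: "1 \<in> col j" if "1 \<le> j" "j \<le> part lam 1" for j
    using that by (auto simp: col_def diagram_def part_def split: if_splits)
  define \<nu> where "\<nu> = map (\<lambda>j. card (col (Suc j))) [0..<part lam 1]"
  have length_nu: "length \<nu> = part lam 1"
    by (simp add: \<nu>_def)
  have part: "part \<nu> j = card (col j)" if "1 \<le> j" "j \<le> part lam 1" for j
    using that by (auto simp: part_def \<nu>_def)
  have anti: "card (col k) \<le> card (col j)" if "1 \<le> j" "j \<le> k" for j k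
    by (rule card_mono[OF fin]) (use that in \<open>auto simp: col_def diagram_def\<close>)
  have pos: "card (col j) > 0" if "1 \<le> j" "j \<le> part lam 1" for j
    using ne[OF that] fin card_gt_0_iff by blast
  have "is_partition \<nu>"
    unfolding is_partition_def
  proof
    show "sorted_wrt (\<ge>) \<nu>"
      unfolding sorted_wrt_iff_nth_less by (auto simp: \<nu>_def intro!: anti)
    show "\<forall>p \<in> set \<nu>. p > 0"
      by (auto simp: \<nu>_def intro!: pos)
  qed
  moreover have "(j, i) \<in> diagram \<nu> \<longleftrightarrow> (i, j) \<in> diagram lam" for j i
  proof -
    have "i \<in> col j \<longleftrightarrow> 1 \<le> i \<and> i \<le> card (col j)"
      by (metis col atLeastAtMost_iff)
    then have "(j, i) \<in> diagram \<nu> \<longleftrightarrow> 1 \<le> j \<and> j \<le> part lam 1 \<and> i \<in> col j"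
      using part[of j] length_nu by (auto simp: diagram_def)
    also have "\<dots> \<longleftrightarrow> (i, j) \<in> diagram lam"
      using part_antimono[OF assms, of 1 i] by (auto simp: col_def diagram_def)
    finally show ?thesis .
  qed
  then have "diagram \<nu> = {(i, j). (j, i) \<in> diagram lam}" by auto
  ultimately show ?thesis by blast
qed

lemma conj_partition:
  assumes "is_partition lam"
  shows "is_partition (conj_partition lam)"
    and "diagram (conj_partition lam) = {(i, j). (j, i) \<in> diagram lam}"
proof -
  have "\<exists>!\<nu>. is_partition \<nu> \<and> diagram \<nu> = {(i, j). (j, i) \<in> diagram lam}"
    using conj_partition_ex[OF assms] diagram_inj by metis
  from theI'[OF this, folded conj_partition_def]
  show "is_partition (conj_partition lam)"
    and "diagram (conj_partition lam) = {(i, j). (j, i) \<in> diagram lam}" by simp_all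
qed

section \<open>Refined dual stable Grothendieck polynomials\<close>

text \<open>\<open>X i\<close> and \<open>T i\<close> stand for the variables $x_i$ and $t_i$ with $i \ge 1$; the variables with
  index 0 do not occur in any of the series below.\<close>

datatype gvar = X nat | T nat

text \<open>Fillings are functions that are \<open>undefined\<close> outside the shape, so that distinct functions
  are distinct fillings.\<close>

definition RPP :: "nat list \<Rightarrow> nat list \<Rightarrow> (nat \<times> nat \<Rightarrow> nat) set" where
  "RPP lam mu = {R \<in> skew_diagram lam mu \<rightarrow>\<^sub>E {1..}.
     (\<forall>i j. (i, j) \<in> skew_diagram lam mu \<and> (i, j + 1) \<in> skew_diagram lam mu \<longrightarrow> R (i, j) \<le> R (i, j + 1)) \<and>
     (\<forall>i j. (i, j) \<in> skew_diagram lam mu \<and> (i + 1, j) \<in> skew_diagram lam mu \<longrightarrow> R (i, j) \<le> R (i + 1, j))}"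

definition x_exponent :: "(nat \<times> nat) set \<Rightarrow> (nat \<times> nat \<Rightarrow> nat) \<Rightarrow> nat \<Rightarrow> nat" where
  "x_exponent D R i = card {j. \<exists>r. (r, j) \<in> D \<and> R (r, j) = i}"

definition t_exponent :: "(nat \<times> nat) set \<Rightarrow> (nat \<times> nat \<Rightarrow> nat) \<Rightarrow> nat \<Rightarrow> nat" where
  "t_exponent D R i = card {j. (i, j) \<in> D \<and> (i + 1, j) \<in> D \<and> R (i, j) = R (i + 1, j)}"

text \<open>Only finitely many factors differ from 1. The factor for \<open>i = 0\<close> equals 1, since entries and
  row indices are positive.\<close>

definition rpp_weight :: "(nat \<times> nat) set \<Rightarrow> (nat \<times> nat \<Rightarrow> nat) \<Rightarrow> (gvar, int) mps" where
  "rpp_weight D R = (\<Prod>i. mps_var (X i) ^ x_exponent D R i * mps_var (T i) ^ t_exponent D R i)"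

definition dual_grothendieck :: "nat list \<Rightarrow> nat list \<Rightarrow> (gvar, int) mps" where
  "dual_grothendieck lam mu =
     (if contained mu lam then mps_sum (rpp_weight (skew_diagram lam mu)) (RPP lam mu) else 0)"

text \<open>The elementary symmetric function of degree \<open>k\<close> in a (possibly infinite) set \<open>V\<close> of
  variables: index sets \<open>i\<^sub>1 < \<dots> < i\<^sub>k\<close> correspond to \<open>k\<close>-element subsets of \<open>V\<close>.\<close>

definition elem_sym :: "int \<Rightarrow> 'v set \<Rightarrow> ('v, int) mps" where
  "elem_sym k V =
     (if k < 0 then 0
      else mps_sum (\<lambda>S. \<Prod>v\<in>S. mps_var v) {S. S \<subseteq> V \<and> finite S \<and> card S = nat k})"

lemma elem_sym_summable:
  "mps_summable (\<lambda>S. \<Prod>v\<in>S. mps_var v :: ('v, int) mps) {S. S \<subseteq> V \<and> finite S \<and> card S = k}"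
  unfolding mps_summable_def
proof
  fix m :: "'v multiset"
  have "S \<subseteq> set_mset m"
    if "finite S" "mps_nth (\<Prod>v\<in>S. mps_var v :: ('v, int) mps) m \<noteq> 0" for S
  proof -
    have "m = (\<Sum>v\<in>S. {#v#})"
      using that(2) by (simp add: mps_var_def mps_monom_sum [symmetric] split: if_splits)
    with that(1) show ?thesis by (auto simp: set_mset_sum)
  qed
  then show "finite {S \<in> {S. S \<subseteq> V \<and> finite S \<and> card S = k}.
      mps_nth (\<Prod>v\<in>S. mps_var v :: ('v, int) mps) m \<noteq> 0}"
    by (intro finite_subset[OF _ finite_Pow_iff[THEN iffD2, OF finite_set_mset[of m]]]) auto
qed

lemma rpp_weight_monom:
  assumes "finite D"
  shows "rpp_weight D R = mps_monom (\<Sum>i \<in> R ` D \<union> fst ` D.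
    replicate_mset (x_exponent D R i) (X i) + replicate_mset (t_exponent D R i) (T i))"
proof -
  have x0: "x_exponent D R i = 0" if "i \<notin> R ` D" for i
  proof -
    have "{j. \<exists>r. (r, j) \<in> D \<and> R (r, j) = i} = {}"
      using that by blast
    then show ?thesis by (simp only: x_exponent_def card.empty)
  qed
  have t0: "t_exponent D R i = 0" if "i \<notin> fst ` D" for i
  proof -
    have "{j. (i, j) \<in> D \<and> (i + 1, j) \<in> D \<and> R (i, j) = R (i + 1, j)} = {}"
      using that by force
    then show ?thesis by (simp only: t_exponent_def card.empty)
  qed
  define M where
    "M i = replicate_mset (x_exponent D R i) (X i) + replicate_mset (t_exponent D R i) (T i)" for i
  have "rpp_weight D R = (\<Prod>i. mps_monom (M i))"
    by (simp add: rpp_weight_def M_def mps_var_power mps_monom_add)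
  also have "\<dots> = (\<Prod>i \<in> R ` D \<union> fst ` D. mps_monom (M i))"
  proof (rule Prod_any.expand_superset)
    show "finite (R ` D \<union> fst ` D)" using assms by simp
    have "M i = {#}" if "i \<notin> R ` D \<union> fst ` D" for i
      using that by (simp add: M_def x0 t0)
    then show "{i. mps_monom (M i) \<noteq> (1 :: (gvar, int) mps)} \<subseteq> R ` D \<union> fst ` D"
      by (metis (mono_tags, lifting) mem_Collect_eq mps_monom_empty subsetI)
  qed
  finally show ?thesis by (simp add: mps_monom_sum M_def)
qed

lemma rpp_summable:
  "mps_summable (rpp_weight (skew_diagram lam mu)) (RPP lam mu)"
  unfolding mps_summable_def
proof
  fix m :: "gvar multiset"
  define D where "D = skew_diagram lam mu"
  have fD: "finite D" by (simp add: D_def skew_diagram_def finite_diagram)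
  have "R \<in> D \<rightarrow>\<^sub>E (X -` set_mset m)"
    if "R \<in> RPP lam mu" "mps_nth (rpp_weight D R) m \<noteq> 0" for R
  proof -
    have m: "m = (\<Sum>i \<in> R ` D \<union> fst ` D.
        replicate_mset (x_exponent D R i) (X i) + replicate_mset (t_exponent D R i) (T i))"
      using that(2) fD by (simp add: rpp_weight_monom split: if_splits)
    have "X (R (r, j)) \<in># m" if "(r, j) \<in> D" for r j
    proof -
      have "finite {j'. \<exists>r'. (r', j') \<in> D \<and> R (r', j') = R (r, j)}"
        by (rule finite_surj[OF fD, of _ snd]) force
      with that have "x_exponent D R (R (r, j)) > 0"
        unfolding x_exponent_def card_gt_0_iff by blast
      then have "X (R (r, j)) \<in># replicate_mset (x_exponent D R (R (r, j))) (X (R (r, j))) +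
          replicate_mset (t_exponent D R (R (r, j))) (T (R (r, j)))"
        by simp
      moreover have "R (r, j) \<in> R ` D \<union> fst ` D" using that by blast
      moreover have "finite (R ` D \<union> fst ` D)" using fD by simp
      ultimately show ?thesis
        by (subst m, subst set_mset_sum) blast+
    qed
    with that(1) show ?thesis by (auto simp: RPP_def D_def PiE_iff)
  qed
  then have "{R \<in> RPP lam mu. mps_nth (rpp_weight D R) m \<noteq> 0} \<subseteq> D \<rightarrow>\<^sub>E (X -` set_mset m)"
    by blast
  moreover have "finite (D \<rightarrow>\<^sub>E (X -` set_mset m))"
    by (intro finite_PiE fD finite_vimageI) (auto simp: inj_def)
  ultimately show "finite {R \<in> RPP lam mu. mps_nth (rpp_weight (skew_diagram lam mu) R) m \<noteq> 0}"
    unfolding D_def by (rule finite_subset)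
qed

end

theory Submission
  imports Defs "HOL-Computational_Algebra.Formal_Power_Series"
begin

text \<open>The proof adds the variables \<open>x\<^sub>1, x\<^sub>2, \<dots>\<close> one at a time and shows that the determinant and the
generating function of reverse plane partitions change in the same way.

Let \<open>\<alpha> = \<lambda>'\<close> and \<open>\<beta> = \<mu>'\<close> be the column lengths. On the combinatorial side, remove the cells with
the largest possible entry \<open>N + 1\<close> from a reverse plane partition. The remaining cells fill a shape
with column lengths \<open>\<gamma>\<close>, where \<open>\<beta> \<le> \<gamma> \<le> \<alpha>\<close> and \<open>\<gamma>\<close> is weakly decreasing, and every such \<open>\<gamma>\<close> occurs.
Column \<open>j\<close> of the removed layer has weight \<open>w(\<gamma>\<^sub>j, \<alpha>\<^sub>j)\<close>, where \<open>w(a, a) = 1\<close> and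
\<open>w(c, a) = x\<^bsub>N+1\<^esub> t\<^bsub>c+1\<^esub> \<cdots> t\<^bsub>a-1\<^esub>\<close> for \<open>c < a\<close> (\<open>rpp_sum_Suc\<close>).

On the algebraic side, row \<open>i\<close> of the matrix consists of coefficients of
\<open>\<phi>\<^sub>i(\<alpha>\<^sub>i) = z\<^bsup>i-\<alpha>\<^sub>i\<^esup> \<Prod>\<^bsub>l<\<alpha>\<^sub>i\<^esub> (1 + t\<^sub>l z)\<close>, multiplied by \<open>\<Prod>\<^bsub>k\<le>N\<^esub> (1 + x\<^sub>k z)\<close> and by a series that depends on
the column only. Two identities hold:
\<open>(1 + x\<^bsub>N+1\<^esub> z) \<phi>\<^sub>i(a) = \<Sum>\<^bsub>c\<le>a\<^esub> w(c, a) \<phi>\<^sub>i(c)\<close> and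
\<open>\<phi>\<^bsub>i+1\<^esub>(a) = z \<phi>\<^sub>i(a) = \<Sum>\<^bsub>c<a\<^esub> t\<^bsub>c+1\<^esub> \<cdots> t\<^bsub>a-1\<^esub> \<phi>\<^sub>i(c)\<close>.
By the first one, the determinant with \<open>N + 1\<close> variables expands over all choices of \<open>c\<^sub>i \<le> \<alpha>\<^sub>i\<close>. By the
second one, for fixed \<open>c\<^bsub>i+1\<^esub>\<close> the terms with \<open>c\<^sub>i < c\<^bsub>i+1\<^esub>\<close> add up to a multiple of the row
\<open>\<phi>\<^bsub>i+1\<^esub>(c\<^bsub>i+1\<^esub>)\<close>, which is already present; so they cancel, and only the decreasing choices survive
(\<open>det_layer_rows\<close>). Those that do not contain \<open>\<beta>\<close> have a zero block, and the recursion is the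
combinatorial one (\<open>jt_det_Suc\<close>). Without \<open>x\<close> variables both sides are 1 if \<open>\<alpha> = \<beta>\<close> and 0 otherwise.

Two further points connect this with the formula. The determinant of the theorem uses elementary symmetric
functions also where \<open>\<alpha>\<^sub>i \<le> \<beta>\<^sub>j\<close>, and there its entries can differ from those above, but then the
monotonicity of \<open>\<alpha>\<close> and \<open>\<beta>\<close> makes these entries irrelevant (\<open>restrict_det_dual_jt\<close>). The passage to
infinitely many \<open>x\<close> variables is made by setting \<open>x\<^sub>k\<close> to zero for \<open>k > N\<close>, a ring homomorphism that
commutes with determinants; two power series that agree after this for every \<open>N\<close> are equal.\<close>

section \<open>Determinants of matrices given by their entries\<close>

lemma det_mat_leibniz:
  "det (mat n n (\<lambda>(i, j). f i j)) =
    (\<Sum>p | p permutes {0..<n}. signof p * (\<Prod>i = 0..<n. f i (p i) :: 'a :: comm_ring_1))"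
proof -
  have "mat n n (\<lambda>(i, j). f i j) $$ (i, p i) = f i (p i)"
    if "p permutes {0..<n}" "i < n" for p i
    using permutes_in_image[OF that(1), of i] that(2) by simp
  then show ?thesis by (subst det_def'[of _ n]) simp_all
qed

lemma det_row_sum:
  fixes \<phi> :: "'b \<Rightarrow> nat \<Rightarrow> 'a :: comm_ring_1"
  assumes "k < n"
  shows "det (mat n n (\<lambda>(i, j). if i = k then \<Sum>c\<in>C. a c * \<phi> c j else \<psi> i j)) =
    (\<Sum>c\<in>C. a c * det (mat n n (\<lambda>(i, j). if i = k then \<phi> c j else \<psi> i j)))"
proof -
  have row: "(\<Prod>i = 0..<n. if i = k then v (p i) else \<psi> i (p i)) =
      v (p k) * (\<Prod>i\<in>{0..<n} - {k}. \<psi> i (p i))" for v :: "nat \<Rightarrow> 'a" and p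
    using assms by (subst prod.remove[of _ k]) (auto intro!: arg_cong2[where f = "(*)"] prod.cong)
  show ?thesis
    unfolding det_mat_leibniz row[of "\<lambda>j. \<Sum>c\<in>C. a c * \<phi> c j"] row[of "\<phi> _"]
      sum_distrib_left sum_distrib_right
    by (subst sum.swap) (simp add: ac_simps)
qed

lemma det_row_add_multiple:
  fixes \<psi> :: "nat \<Rightarrow> nat \<Rightarrow> 'a :: comm_ring_1"
  assumes "k < n" "m < n" "k \<noteq> m"
  shows "det (mat n n (\<lambda>(i, j). if i = k then u j + a * \<psi> m j else \<psi> i j)) =
    det (mat n n (\<lambda>(i, j). if i = k then u j else \<psi> i j))"
proof -
  have "det (mat n n (\<lambda>(i, j). if i = k then u j + a * \<psi> m j else \<psi> i j)) =
      det (mat n n (\<lambda>(i, j). if i = k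
        then \<Sum>c\<in>UNIV. (if c then 1 else a) * (if c then u else \<psi> m) j else \<psi> i j))"
    by (rule arg_cong[of _ _ det]) (auto simp: UNIV_bool add.commute)
  also have "\<dots> = (\<Sum>c\<in>UNIV. (if c then 1 else a) *
      det (mat n n (\<lambda>(i, j). if i = k then (if c then u else \<psi> m) j else \<psi> i j)))"
    by (rule det_row_sum[OF assms(1)])
  also have "\<dots> = det (mat n n (\<lambda>(i, j). if i = k then u j else \<psi> i j)) +
      a * det (mat n n (\<lambda>(i, j). if i = k then \<psi> m j else \<psi> i j))"
    by (simp add: UNIV_bool add.commute)
  also have "det (mat n n (\<lambda>(i, j). if i = k then \<psi> m j else \<psi> i j)) = 0"
    by (rule det_identical_rows[of _ n k m]) (use assms in auto)
  finally show ?thesis by simp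
qed

lemma permutes_meets:
  assumes "p permutes {0..<n}" "A \<subseteq> {0..<n}" "B \<subseteq> {0..<n}" "card A + card B > n"
  shows "\<exists>i\<in>A. p i \<in> B"
proof (rule ccontr)
  assume "\<not> ?thesis"
  then have "p ` A \<inter> B = {}" by auto
  moreover have "p ` A \<subseteq> {0..<n}" using assms(1,2) permutes_image by blast
  moreover have "card (p ` A) = card A"
    by (rule card_image) (meson assms(1) inj_on_subset permutes_inj subset_UNIV)
  ultimately have "card A + card B = card (p ` A \<union> B)"
    using assms(2,3) by (subst card_Un_disjoint) (auto intro: finite_subset)
  also have "\<dots> \<le> card {0..<n}"
    using \<open>p ` A \<subseteq> {0..<n}\<close> assms(3) by (intro card_mono) auto
  finally show False using assms(4) by simp
qed

text \<open>An \<open>a \<times> b\<close> block of zeros with \<open>a + b > n\<close> meets every permutation, so that every term of the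
Leibniz expansion vanishes.\<close>

lemma det_zero_block:
  fixes f :: "nat \<Rightarrow> nat \<Rightarrow> 'a :: comm_ring_1"
  assumes "A \<subseteq> {0..<n}" "B \<subseteq> {0..<n}" "card A + card B > n"
    and "\<And>i j. i \<in> A \<Longrightarrow> j \<in> B \<Longrightarrow> f i j = 0"
  shows "det (mat n n (\<lambda>(i, j). f i j)) = 0"
  unfolding det_mat_leibniz
proof (intro sum.neutral ballI)
  fix p assume "p \<in> {p. p permutes {0..<n}}"
  then obtain i where "i \<in> A" "p i \<in> B" using permutes_meets[of p n A B] assms by auto
  with assms have "(\<Prod>i = 0..<n. f i (p i)) = 0" by (intro prod_zero) (auto intro!: bexI[of _ i])
  then show "signof p * (\<Prod>i = 0..<n. f i (p i)) = 0" by simp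
qed

text \<open>Suppose that the rows below \<open>i\<close> vanish in the columns up to \<open>i\<close>. A permutation with a nonzero
Leibniz term then maps the rows below \<open>i\<close> onto the columns right of \<open>i\<close>, and no column right of
\<open>i\<close> is left for row \<open>i\<close>: the entries \<open>(i, j)\<close> with \<open>i < j\<close> have no influence on the determinant.
This is used for the entries with \<open>\<alpha>\<^sub>i \<le> \<beta>\<^sub>j\<close> and \<open>i < j\<close>, where the list of \<open>t\<close> variables is
empty.\<close>

lemma det_cong_irrelevant:
  fixes f g :: "nat \<Rightarrow> nat \<Rightarrow> 'a :: comm_ring_1"
  assumes "\<And>i j. i < n \<Longrightarrow> j < n \<Longrightarrow> f i j = g i j \<or>
    (i < j \<and> (\<forall>r q. i < r \<longrightarrow> r < n \<longrightarrow> q \<le> i \<longrightarrow> f r q = 0 \<and> g r q = 0))"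
  shows "det (mat n n (\<lambda>(i, j). f i j)) = det (mat n n (\<lambda>(i, j). g i j))"
  unfolding det_mat_leibniz
proof (intro sum.cong refl)
  fix p assume "p \<in> {p. p permutes {0..<n}}"
  then have p: "p permutes {0..<n}" by simp
  have "(\<Prod>i = 0..<n. f i (p i)) = (\<Prod>i = 0..<n. g i (p i))"
  proof (cases "\<forall>i<n. f i (p i) = g i (p i)")
    case False
    then obtain i where i: "i < n" "f i (p i) \<noteq> g i (p i)" by blast
    have pi: "p i < n" using p i(1) by simp
    have lt: "i < p i" and z: "\<And>r q. i < r \<Longrightarrow> r < n \<Longrightarrow> q \<le> i \<Longrightarrow> f r q = 0 \<and> g r q = 0"
      using assms[OF i(1) pi] i(2) by auto
    obtain r where r: "r \<in> {i<..<n}" "p r \<in> insert (p i) {0..i}"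
      using permutes_meets[OF p, of "{i<..<n}" "insert (p i) {0..i}"] i(1) pi lt
    by (force simp: card_insert_if)
    have "p r \<noteq> p i" using r(1) permutes_inj[OF p] by (auto dest: injD)
    with r have "f r (p r) = 0 \<and> g r (p r) = 0" by (intro z) auto
    with r(1) have "(\<Prod>i = 0..<n. f i (p i)) = 0" "(\<Prod>i = 0..<n. g i (p i)) = 0"
      by (auto intro!: prod_zero bexI[of _ r])
    then show ?thesis by simp
  qed simp
  then show "signof p * (\<Prod>i = 0..<n. f i (p i)) = signof p * (\<Prod>i = 0..<n. g i (p i))"
    by simp
qed

section \<open>The series of a column\<close>

text \<open>Integer exponents make the shift \<open>j - i\<close> of the determinant harmless: coefficients at negative
exponents are zero, just as \<open>e\<^sub>k = 0\<close> for \<open>k < 0\<close>.\<close>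

definition fps_at :: "'a :: zero fps \<Rightarrow> int \<Rightarrow> 'a" where
  "fps_at f k = (if k < 0 then 0 else fps_nth f (nat k))"

definition lin_factor :: "'a :: comm_ring_1 \<Rightarrow> 'a fps" where
  "lin_factor c = 1 + fps_const c * fps_X"

definition lin_factor_inv :: "'a :: comm_ring_1 \<Rightarrow> 'a fps" where
  "lin_factor_inv c = Abs_fps (\<lambda>n. (- c) ^ n)"

lemma fps_at_neg [simp]: "k < 0 \<Longrightarrow> fps_at f k = 0"
  by (simp add: fps_at_def)

lemma fps_at_lin_mult: "fps_at (lin_factor c * f) k = fps_at f k + c * fps_at f (k - 1)"
proof (cases "k \<le> 0")
  case True
  then show ?thesis by (auto simp: fps_at_def lin_factor_def algebra_simps fps_mult_nth)
next
  case False
  then obtain m where "k = int (Suc m)" by (metis not_le zero_less_imp_eq_int gr0_conv_Suc)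
  then show ?thesis
    by (simp add: fps_at_def lin_factor_def distrib_right mult.assoc nat_add_distrib)
qed

lemma lin_mult_inv [simp]: "lin_factor c * lin_factor_inv c = 1"
proof (rule fps_ext)
  fix k
  show "fps_nth (lin_factor c * lin_factor_inv c) k = fps_nth 1 k"
    by (cases k) (simp_all add: lin_factor_def lin_factor_inv_def distrib_right mult.assoc)
qed

text \<open>With \<open>z\<close> for the formal variable, the generating function of the elementary symmetric polynomials in
\<open>x\<^sub>1, \<dots>, x\<^sub>N, t\<^bsub>b+1\<^esub>, \<dots>, t\<^bsub>a-1\<^esub>\<close> is the product of the factors \<open>1 + x\<^sub>k z\<close> and \<open>1 + t\<^sub>l z\<close>. Here it is
written as the product of the \<open>1 + x\<^sub>k z\<close>, of the \<open>1 + t\<^sub>l z\<close> with \<open>L \<le> l < a\<close>, and of the inverses of the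
\<open>1 + t\<^sub>l z\<close> with \<open>L \<le> l \<le> b\<close>. In this form the dependence on \<open>a\<close>, which belongs to the row of the
matrix, is separated from the dependence on \<open>b\<close>, which belongs to its column, and the recurrence in
\<open>a\<close> holds for all \<open>a \<ge> L\<close>, also below \<open>b\<close>. The base point \<open>L\<close> is arbitrary; it cancels for
\<open>a > b\<close>, and it is taken so low that the recurrence in \<open>a\<close> can be run down to a vanishing entry.\<close>

definition col_series :: "(nat \<Rightarrow> 'a :: comm_ring_1) \<Rightarrow> (int \<Rightarrow> 'a) \<Rightarrow> int \<Rightarrow> nat \<Rightarrow> int \<Rightarrow> int \<Rightarrow> 'a fps"
  where "col_series x t L N a b =
    (\<Prod>k = 1..N. lin_factor (x k)) * (\<Prod>l\<in>{L..<a}. lin_factor (t l)) * (\<Prod>l\<in>{L..b}. lin_factor_inv (t l))"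

lemma prod_lin_mult_inv: "(\<Prod>l\<in>A. lin_factor (t l)) * (\<Prod>l\<in>A. lin_factor_inv (t l)) = 1"
  by (simp add: prod.distrib [symmetric])

lemma col_series_Suc_N: "col_series x t L (Suc N) a b = lin_factor (x (Suc N)) * col_series x t L N a b"
  by (simp add: col_series_def ac_simps)

lemma col_series_Suc_a:
  assumes "L \<le> a"
  shows "col_series x t L N (a + 1) b = lin_factor (t a) * col_series x t L N a b"
proof -
  have "{L..<a + 1} = insert a {L..<a}" using assms by auto
  then show ?thesis by (simp add: col_series_def ac_simps)
qed

lemma col_series_gt:
  assumes "L \<le> b + 1" "b < a"
  shows "col_series x t L N a b = (\<Prod>k = 1..N. lin_factor (x k)) * (\<Prod>l\<in>{b<..<a}. lin_factor (t l))"
proof -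
  have "{L..<a} = {b<..<a} \<union> {L..b}" "{b<..<a} \<inter> {L..b} = {}" using assms by auto
  then have "(\<Prod>l\<in>{L..<a}. lin_factor (t l)) = (\<Prod>l\<in>{b<..<a}. lin_factor (t l)) * (\<Prod>l\<in>{L..b}. lin_factor (t l))"
    by (simp add: prod.union_disjoint)
  then have "col_series x t L N a b = (\<Prod>k = 1..N. lin_factor (x k)) * (\<Prod>l\<in>{b<..<a}. lin_factor (t l)) *
      ((\<Prod>l\<in>{L..b}. lin_factor (t l)) * (\<Prod>l\<in>{L..b}. lin_factor_inv (t l)))"
    unfolding col_series_def by (simp only: mult.assoc)
  then show ?thesis unfolding prod_lin_mult_inv by simp
qed

lemma fps_nth_0_prod: "fps_nth (\<Prod>i\<in>A. f i) 0 = (\<Prod>i\<in>A. fps_nth (f i) 0)"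
  by (induction A rule: infinite_finite_induct) simp_all

lemma col_series_nth_0: "fps_nth (col_series x t L N a b) 0 = 1"
  by (simp add: col_series_def fps_nth_0_prod lin_factor_def lin_factor_inv_def)

text \<open>Row \<open>i\<close> of the matrix, as a function of the length \<open>a\<close> of its column, is the list of coefficients of
\<open>\<phi>\<^sub>i(a) = z\<^bsup>i-a\<^esup> \<Prod>\<^bsub>L\<le>l<a\<^esub> (1 + t\<^sub>l z)\<close> against series that do not depend on the row. Replacing \<open>i\<close>
by \<open>i + 1\<close> is multiplication by \<open>z\<close>.\<close>

definition entry ::
    "(nat \<Rightarrow> 'a :: comm_ring_1) \<Rightarrow> (int \<Rightarrow> 'a) \<Rightarrow> int \<Rightarrow> nat \<Rightarrow> (nat \<Rightarrow> int) \<Rightarrow> nat \<Rightarrow> int \<Rightarrow> nat \<Rightarrow> 'a"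
  where "entry x t L N \<beta> i a j =
    fps_at (col_series x t L N a (\<beta> j)) (a - \<beta> j - int i + int j)"

text \<open>The weight of the part of one column, from row \<open>c + 1\<close> to row \<open>a\<close>, that is filled with a single
value whose variable is \<open>y\<close>.\<close>

definition layer_weight :: "'a :: comm_ring_1 \<Rightarrow> (int \<Rightarrow> 'a) \<Rightarrow> int \<Rightarrow> int \<Rightarrow> 'a" where
  "layer_weight y t c a = (if c = a then 1 else y * (\<Prod>l\<in>{c<..<a}. t l))"

lemma entry_Suc_N:
  "entry x t L (Suc N) \<beta> i a j = entry x t L N \<beta> i a j + x (Suc N) * entry x t L N \<beta> (Suc i) a j"
  by (simp add: entry_def col_series_Suc_N fps_at_lin_mult algebra_simps)

text \<open>Iterating \<open>z \<phi>\<^sub>i(a + 1) = \<phi>\<^sub>i(a) + t\<^sub>a z \<phi>\<^sub>i(a)\<close> writes \<open>\<phi>\<^bsub>i+1\<^esub>(a) = z \<phi>\<^sub>i(a)\<close> as a combination of the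
\<open>\<phi>\<^sub>i(c)\<close> with \<open>c < a\<close>. The iteration ends at \<open>L\<close>, where the exponent is negative for every
column, because \<open>L\<close> lies at least \<open>n\<close> below all \<open>\<beta>\<^sub>j\<close>.\<close>

lemma entry_Suc_i:
  assumes "L \<le> a" "j < n" "L + int n \<le> \<beta> j"
  shows "entry x t L N \<beta> (Suc i) a j =
    (\<Sum>c\<in>{L..<a}. (\<Prod>l\<in>{c<..<a}. t l) * entry x t L N \<beta> i c j)"
  using assms(1)
proof (induction a rule: int_ge_induct)
  case base
  show ?case using assms(2,3) by (simp add: entry_def)
next
  case (step a)
  have *: "{L..<a + 1} = insert a {L..<a}" using step.hyps by auto
  have empty: "{a<..<a + 1} = {}" by auto
  have **: "{c<..<a + 1} = insert a {c<..<a}" if "c < a" for c using that by auto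
  have "entry x t L N \<beta> (Suc i) (a + 1) j =
      entry x t L N \<beta> i a j + t a * entry x t L N \<beta> (Suc i) a j"
    unfolding entry_def col_series_Suc_a[OF step.hyps] fps_at_lin_mult by (simp add: algebra_simps)
  also have "\<dots> = entry x t L N \<beta> i a j +
      (\<Sum>c\<in>{L..<a}. (\<Prod>l\<in>{c<..<a + 1}. t l) * entry x t L N \<beta> i c j)"
    by (simp add: step.IH ** sum_distrib_left mult.assoc)
  also have "\<dots> = (\<Sum>c\<in>{L..<a + 1}. (\<Prod>l\<in>{c<..<a + 1}. t l) * entry x t L N \<beta> i c j)"
    by (simp add: * empty)
  finally show ?case .
qed

lemma entry_layer:
  assumes "L \<le> a" "j < n" "L + int n \<le> \<beta> j"
  shows "entry x t L (Suc N) \<beta> i a j =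
    (\<Sum>c\<in>{L..a}. layer_weight (x (Suc N)) t c a * entry x t L N \<beta> i c j)"
proof -
  have "{L..a} = insert a {L..<a}" using assms(1) by auto
  then show ?thesis
    by (simp add: entry_Suc_N entry_Suc_i[where \<beta> = \<beta>, OF assms] layer_weight_def sum_distrib_left mult.assoc)
qed

text \<open>For \<open>c < b \<le> a\<close> the product \<open>t\<^bsub>c+1\<^esub> \<cdots> t\<^bsub>a-1\<^esub>\<close> splits at \<open>b\<close>, and the factor right of the split does
not depend on \<open>c\<close>. Hence all terms with \<open>c < b\<close> together are a multiple of \<open>\<phi>\<^bsub>i+1\<^esub>(b)\<close>. If this is
the next row of a matrix, they do not contribute to its determinant.\<close>

lemma entry_layer_from:
  assumes "L \<le> b" "b \<le> a" "j < n" "L + int n \<le> \<beta> j"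
  shows "entry x t L (Suc N) \<beta> i a j =
    (\<Sum>c\<in>{b..a}. layer_weight (x (Suc N)) t c a * entry x t L N \<beta> i c j) +
    (x (Suc N) * (\<Prod>l\<in>{b..<a}. t l)) * entry x t L N \<beta> (Suc i) b j"
proof -
  have "{L..a} = {L..<b} \<union> {b..a}" "{L..<b} \<inter> {b..a} = {}" using assms(1,2) by auto
  then have "entry x t L (Suc N) \<beta> i a j =
      (\<Sum>c\<in>{L..<b}. layer_weight (x (Suc N)) t c a * entry x t L N \<beta> i c j) +
      (\<Sum>c\<in>{b..a}. layer_weight (x (Suc N)) t c a * entry x t L N \<beta> i c j)"
    using assms by (simp add: entry_layer sum.union_disjoint)
  also have "layer_weight (x (Suc N)) t c a =
      x (Suc N) * (\<Prod>l\<in>{b..<a}. t l) * (\<Prod>l\<in>{c<..<b}. t l)" if "c < b" for c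
  proof -
    have "{c<..<a} = {c<..<b} \<union> {b..<a}" "{c<..<b} \<inter> {b..<a} = {}" using that assms(2) by auto
    then have "(\<Prod>l\<in>{c<..<a}. t l) = (\<Prod>l\<in>{c<..<b}. t l) * (\<Prod>l\<in>{b..<a}. t l)"
      by (simp add: prod.union_disjoint)
    then show ?thesis using that assms(2) by (simp add: layer_weight_def ac_simps)
  qed
  then have "(\<Sum>c\<in>{L..<b}. layer_weight (x (Suc N)) t c a * entry x t L N \<beta> i c j) =
      (x (Suc N) * (\<Prod>l\<in>{b..<a}. t l)) * entry x t L N \<beta> (Suc i) b j"
    using assms by (simp add: entry_Suc_i sum_distrib_left mult.assoc)
  finally show ?thesis by simp
qed

section \<open>Adding one variable to the determinant\<close>

definition decreasing_from :: "nat \<Rightarrow> nat \<Rightarrow> int \<Rightarrow> (nat \<Rightarrow> int) \<Rightarrow> (nat \<Rightarrow> int) set" where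
  "decreasing_from k n L \<alpha> = {f \<in> (\<Pi>\<^sub>E i\<in>{k..<n}. {L..\<alpha> i}).
     \<forall>i. k \<le> i \<and> Suc i < n \<longrightarrow> f (Suc i) \<le> f i}"

lemma finite_decreasing_from: "finite (decreasing_from k n L \<alpha>)"
proof (rule finite_subset)
  show "decreasing_from k n L \<alpha> \<subseteq> (\<Pi>\<^sub>E i\<in>{k..<n}. {L..\<alpha> i})"
    by (auto simp: decreasing_from_def PiE_def)
  show "finite (\<Pi>\<^sub>E i\<in>{k..<n}. {L..\<alpha> i})"
    by (intro finite_PiE) auto
qed

lemma sum_decreasing_from:
  fixes G :: "(nat \<Rightarrow> int) \<Rightarrow> 'a :: comm_monoid_add"
  assumes "k < n"
  shows "(\<Sum>f\<in>decreasing_from k n L \<alpha>. G f) =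
    (\<Sum>f\<in>decreasing_from (Suc k) n L \<alpha>.
       \<Sum>c\<in>{(if Suc k < n then f (Suc k) else L)..\<alpha> k}. G (f(k := c)))"
proof -
  let ?I = "\<lambda>f. {(if Suc k < n then f (Suc k) else L)..\<alpha> k}"
  have "(\<Sum>f\<in>decreasing_from k n L \<alpha>. G f) =
      (\<Sum>(f, c)\<in>(SIGMA f:decreasing_from (Suc k) n L \<alpha>. ?I f). G (f(k := c)))"
  proof (rule sum.reindex_bij_witness[where i = "\<lambda>(f, c). f(k := c)"
        and j = "\<lambda>f. (f(k := undefined), f k)"], goal_cases)
    case (1 f)
    then show ?case by simp
  next
    case (2 f)
    then show ?case using assms
      by (auto simp: decreasing_from_def PiE_iff extensional_def)
  next
    case (3 b)
    then show ?case
      by (auto simp: decreasing_from_def PiE_iff extensional_def fun_eq_iff)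
  next
    case (4 b)
    then obtain f c where b: "b = (f, c)" and f: "f \<in> decreasing_from (Suc k) n L \<alpha>"
      and c: "c \<in> ?I f" by auto
    have "L \<le> c"
    proof (cases "Suc k < n")
      case True
      then have "L \<le> f (Suc k)" using f by (auto simp: decreasing_from_def)
      with c True show ?thesis by simp
    qed (use c in auto)
    moreover have "c \<le> \<alpha> k" "Suc k < n \<Longrightarrow> f (Suc k) \<le> c" using c by auto
    ultimately show ?case using assms f unfolding b decreasing_from_def PiE_iff
      by (auto simp: extensional_def Suc_le_eq order.order_iff_strict[of k])
  next
    case (5 f)
    then show ?case by simp
  qed
  also have "\<dots> = (\<Sum>f\<in>decreasing_from (Suc k) n L \<alpha>. \<Sum>c\<in>?I f. G (f(k := c)))"
    by (rule sum.Sigma [symmetric]) (auto simp: finite_decreasing_from)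
  finally show ?thesis .
qed

text \<open>The rows are expanded one after the other, beginning with the last. When row \<open>k\<close> is
expanded, row \<open>k + 1\<close> has already become \<open>\<phi>\<^bsub>k+1\<^esub>(f (k + 1))\<close>, so that the terms of row \<open>k\<close> with
\<open>c < f (k + 1)\<close> form a multiple of row \<open>k + 1\<close> and cancel. What remains are exactly the weakly
decreasing choices, that is, the shapes that a reverse plane partition can have once its largest
entries are removed. The parameter \<open>k\<close> counts the rows that are not yet expanded.\<close>

lemma det_layer_rows:
  fixes x :: "nat \<Rightarrow> 'a :: comm_ring_1"
  assumes "\<And>i. Suc i < n \<Longrightarrow> \<alpha> (Suc i) \<le> \<alpha> i" and "\<And>i. i < n \<Longrightarrow> L \<le> \<alpha> i"
    and "\<And>j. j < n \<Longrightarrow> L + int n \<le> \<beta> j" and "k \<le> n"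
  shows "det (mat n n (\<lambda>(i, j). entry x t L (Suc N) \<beta> i (\<alpha> i) j)) =
    (\<Sum>f\<in>decreasing_from k n L \<alpha>. (\<Prod>i\<in>{k..<n}. layer_weight (x (Suc N)) t (f i) (\<alpha> i)) *
       det (mat n n (\<lambda>(i, j). if i < k then entry x t L (Suc N) \<beta> i (\<alpha> i) j
         else entry x t L N \<beta> i (f i) j)))"
  using assms(4)
proof (induction k rule: inc_induct)
  case base
  have empty: "decreasing_from n n L \<alpha> = {\<lambda>_. undefined}" by (auto simp: decreasing_from_def)
  moreover have "det (mat n n (\<lambda>(i, j). entry x t L (Suc N) \<beta> i (\<alpha> i) j)) =
      det (mat n n (\<lambda>(i, j). if i < n then entry x t L (Suc N) \<beta> i (\<alpha> i) j
        else entry x t L N \<beta> i undefined j))"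
    by (intro arg_cong[of _ _ det] cong_mat) auto
  ultimately show ?case unfolding empty by simp
next
  case (step k)
  let ?w = "\<lambda>c i. layer_weight (x (Suc N)) t c (\<alpha> i)"
  let ?M = "\<lambda>k f. det (mat n n (\<lambda>(i, j). if i < k then entry x t L (Suc N) \<beta> i (\<alpha> i) j
         else entry x t L N \<beta> i (f i) j))"
  have row: "?M (Suc k) f =
      (\<Sum>c\<in>{(if Suc k < n then f (Suc k) else L)..\<alpha> k}. ?w c k * ?M k (f(k := c)))"
    if f: "f \<in> decreasing_from (Suc k) n L \<alpha>" for f
  proof -
    let ?lo = "if Suc k < n then f (Suc k) else L"
    let ?R = "\<lambda>i j. if i < k then entry x t L (Suc N) \<beta> i (\<alpha> i) j else entry x t L N \<beta> i (f i) j"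
    let ?u = "\<lambda>j. \<Sum>c\<in>{?lo..\<alpha> k}. ?w c k * entry x t L N \<beta> k c j"
    have "?M (Suc k) f = det (mat n n (\<lambda>(i, j). if i = k then ?u j else ?R i j))"
    proof (cases "Suc k < n")
      case True
      then have "f (Suc k) \<in> {L..\<alpha> (Suc k)}"
        using f by (auto simp: decreasing_from_def PiE_iff)
      with assms(1)[OF True] have lo: "L \<le> f (Suc k)" "f (Suc k) \<le> \<alpha> k" by auto
      \<comment> \<open>the multiple of row \<open>k + 1\<close> that the terms below \<open>f (k + 1)\<close> add up to\<close>
      let ?a = "x (Suc N) * (\<Prod>l\<in>{f (Suc k)..<\<alpha> k}. t l)"
      have "?M (Suc k) f =
          det (mat n n (\<lambda>(i, j). if i = k then ?u j + ?a * ?R (Suc k) j else ?R i j))"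
        using True lo assms(3)
        by (intro arg_cong[of _ _ det] cong_mat refl)
          (auto simp: less_Suc_eq entry_layer_from[OF lo, of _ n])
      then show ?thesis using step.hyps True by (subst (asm) det_row_add_multiple) auto
    next
      case False
      with step.hyps have "n = Suc k" by simp
      then show ?thesis using assms(2,3)
        by (intro arg_cong[of _ _ det] cong_mat refl)
          (auto simp: less_Suc_eq entry_layer[of _ _ _ n])
    qed
    also have "\<dots> = (\<Sum>c\<in>{?lo..\<alpha> k}. ?w c k *
        det (mat n n (\<lambda>(i, j). if i = k then entry x t L N \<beta> k c j else ?R i j)))"
      using step.hyps by (intro det_row_sum) auto
    also have "\<dots> = (\<Sum>c\<in>{?lo..\<alpha> k}. ?w c k * ?M k (f(k := c)))"
      by (intro sum.cong refl arg_cong2[where f = "(*)"] arg_cong[of _ _ det] cong_mat) auto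
    finally show ?thesis .
  qed
  have w: "(\<Prod>i\<in>{k..<n}. ?w ((f(k := c)) i) i) = ?w c k * (\<Prod>i\<in>{Suc k..<n}. ?w (f i) i)" for f c
    using step.hyps by (simp add: prod.atLeast_Suc_lessThan)
  have "det (mat n n (\<lambda>(i, j). entry x t L (Suc N) \<beta> i (\<alpha> i) j)) =
      (\<Sum>f\<in>decreasing_from (Suc k) n L \<alpha>. (\<Prod>i\<in>{Suc k..<n}. ?w (f i) i) * ?M (Suc k) f)"
    by (rule step.IH)
  also have "\<dots> = (\<Sum>f\<in>decreasing_from k n L \<alpha>. (\<Prod>i\<in>{k..<n}. ?w (f i) i) * ?M k f)"
    using step.hyps
    by (subst sum_decreasing_from) (simp_all add: row w sum_distrib_left ac_simps del: fun_upd_apply)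
  finally show ?case .
qed

lemma fps_nth_prod_lin:
  assumes "finite A"
  shows "fps_nth (\<Prod>i\<in>A. lin_factor (c i)) k = (\<Sum>S | S \<subseteq> A \<and> card S = k. \<Prod>i\<in>S. c i)"
proof -
  have "(\<Prod>i\<in>A. lin_factor (c i)) = (\<Sum>S\<in>Pow A. fps_const (\<Prod>i\<in>S. c i) * fps_X ^ card S)"
  proof -
    have "(\<Prod>i\<in>S. fps_const (c i) * fps_X) = fps_const (\<Prod>i\<in>S. c i) * fps_X ^ card S" for S
      by (induction S rule: infinite_finite_induct) (simp_all add: ac_simps flip: fps_const_mult)
    then show ?thesis
      using assms by (simp add: lin_factor_def add.commute[of 1] prod_add)
  qed
  then have "fps_nth (\<Prod>i\<in>A. lin_factor (c i)) k =
      (\<Sum>S\<in>Pow A. if card S = k then \<Prod>i\<in>S. c i else 0)"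
    by (auto simp: fps_sum_nth intro!: sum.cong)
  also have "\<dots> = (\<Sum>S | S \<subseteq> A \<and> card S = k. \<Prod>i\<in>S. c i)"
    using assms by (intro sum.mono_neutral_cong_right) auto
  finally show ?thesis .
qed

lemma fps_nth_prod_lin_eq_0:
  assumes "finite A" "card A < k"
  shows "fps_nth (\<Prod>i\<in>A. lin_factor (c i)) k = 0"
proof -
  have "{S. S \<subseteq> A \<and> card S = k} = {}"
    using assms card_mono[OF assms(1)] by (auto simp: not_le[symmetric])
  then show ?thesis by (simp only: fps_nth_prod_lin[OF assms(1)] sum.empty)
qed

lemma antimono_from_steps:
  fixes f :: "nat \<Rightarrow> 'b :: order"
  assumes "i \<le> j" "\<And>k. i \<le> k \<Longrightarrow> k < j \<Longrightarrow> f (Suc k) \<le> f k"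
  shows "f j \<le> f i"
  using assms
proof (induction j rule: dec_induct)
  case (step m)
  have "f (Suc m) \<le> f m" using step.hyps step.prems by simp
  also have "f m \<le> f i" using step.IH step.prems by simp
  finally show ?case .
qed simp

lemma det_entry_not_contained:
  assumes "i < n" "a i < \<beta> i"
    and "\<And>p. i \<le> p \<Longrightarrow> p < n \<Longrightarrow> a p \<le> a i" and "\<And>q. q \<le> i \<Longrightarrow> \<beta> i \<le> \<beta> q"
  shows "det (mat n n (\<lambda>(i, j). entry x t L N \<beta> i (a i) j)) = 0"
proof (rule det_zero_block[of "{i..<n}" n "{0..i}"])
  fix p q assume "p \<in> {i..<n}" "q \<in> {0..i}"
  then have "a p \<le> a i" "\<beta> i \<le> \<beta> q" "q \<le> p" using assms(3,4) by auto
  with assms(2) have "a p < \<beta> q" "q \<le> p" by auto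
  then show "entry x t L N \<beta> p (a p) q = 0" by (simp add: entry_def)
qed (use assms(1) in auto)

text \<open>Without \<open>x\<close> variables the entry \<open>(i, j)\<close> with \<open>a\<^sub>i > \<beta>\<^sub>j\<close> is a coefficient of a polynomial of degree at
most \<open>a\<^sub>i - \<beta>\<^sub>j - 1\<close>, at the exponent \<open>a\<^sub>i - \<beta>\<^sub>j + (j - i)\<close>; so it vanishes for \<open>j \<ge> i\<close>. One index with
\<open>a\<^sub>i > \<beta>\<^sub>i\<close> therefore produces a block of zeros in the upper right corner that is too large for the
determinant to survive.\<close>

lemma det_entry_no_variables:
  assumes "\<And>i j. i \<le> j \<Longrightarrow> j < n \<Longrightarrow> a j \<le> a i" "\<And>i j. i \<le> j \<Longrightarrow> j < n \<Longrightarrow> \<beta> j \<le> \<beta> i"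
    and "\<And>j. j < n \<Longrightarrow> L \<le> \<beta> j" "\<And>j. j < n \<Longrightarrow> \<beta> j \<le> a j"
  shows "det (mat n n (\<lambda>(i, j). entry x t L 0 \<beta> i (a i) j)) = (if \<forall>i<n. a i = \<beta> i then 1 else 0)"
proof (cases "\<forall>i<n. a i = \<beta> i")
  case True
  let ?M = "mat n n (\<lambda>(i, j). entry x t L 0 \<beta> i (a i) j)"
  have "?M $$ (i, j) = 0" if "j < i" "i < n" for i j
    using that True assms(1)[of j i] by (auto simp: entry_def)
  then have "upper_triangular ?M" by auto
  then have "det ?M = prod_list (diag_mat ?M)"
    by (rule det_upper_triangular) auto
  also have "diag_mat ?M = replicate n 1"
    using True by (auto intro!: nth_equalityI simp: diag_mat_def entry_def fps_at_def col_series_nth_0)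
  finally show ?thesis using True by (simp add: prod_list_replicate)
next
  case False
  then obtain i where i: "i < n" "\<beta> i < a i" using assms(4) by (metis order_le_less)
  have "det (mat n n (\<lambda>(i, j). entry x t L 0 \<beta> i (a i) j)) = 0"
  proof (rule det_zero_block[of "{0..i}" n "{i..<n}"])
    fix p q assume pq: "p \<in> {0..i}" "q \<in> {i..<n}"
    have "a i \<le> a p" "\<beta> q \<le> \<beta> i" using pq i assms(1)[of p i] assms(2)[of i q] by auto
    then have lt: "\<beta> q < a p" using i(2) by simp
    have "entry x t L 0 \<beta> p (a p) q =
        fps_nth (\<Prod>l\<in>{\<beta> q<..<a p}. lin_factor (t l)) (nat (a p - \<beta> q - int p + int q))"
      using lt pq assms(3)[of q] by (simp add: entry_def fps_at_def col_series_gt)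
    also have "\<dots> = 0" using lt pq by (intro fps_nth_prod_lin_eq_0) auto
    finally show "entry x t L 0 \<beta> p (a p) q = 0" .
  qed (use i in auto)
  with False show ?thesis by auto
qed

text \<open>The shapes between \<open>\<beta>\<close> and \<open>\<alpha>\<close>, given by their column lengths. Columns are counted from 1 here,
whereas matrix rows and columns are counted from 0.\<close>

definition between :: "nat \<Rightarrow> (nat \<Rightarrow> nat) \<Rightarrow> (nat \<Rightarrow> nat) \<Rightarrow> (nat \<Rightarrow> nat) set" where
  "between n \<beta> \<alpha> = {\<gamma> \<in> (\<Pi>\<^sub>E j\<in>{1..n}. {\<beta> j..\<alpha> j}). \<forall>j. 1 \<le> j \<and> j < n \<longrightarrow> \<gamma> (Suc j) \<le> \<gamma> j}"

definition decreasing :: "nat \<Rightarrow> (nat \<Rightarrow> nat) \<Rightarrow> bool" where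
  "decreasing n \<alpha> \<longleftrightarrow> (\<forall>i j. 1 \<le> i \<longrightarrow> i \<le> j \<longrightarrow> j \<le> n \<longrightarrow> \<alpha> j \<le> \<alpha> i)"

text \<open>The base point \<open>-n\<close> lies at least \<open>n\<close> below every column length.\<close>

definition jt_det ::
    "(nat \<Rightarrow> 'a :: comm_ring_1) \<Rightarrow> (int \<Rightarrow> 'a) \<Rightarrow> nat \<Rightarrow> nat \<Rightarrow> (nat \<Rightarrow> nat) \<Rightarrow> (nat \<Rightarrow> nat) \<Rightarrow> 'a" where
  "jt_det x t n N \<alpha> \<beta> = det (mat n n (\<lambda>(i, j).
     entry x t (- int n) N (\<lambda>j. int (\<beta> (Suc j))) i (int (\<alpha> (Suc i))) j))"

lemma between_decreasing: "\<gamma> \<in> between n \<beta> \<alpha> \<Longrightarrow> decreasing n \<gamma>"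
  unfolding decreasing_def
proof (intro allI impI)
  fix i j assume "\<gamma> \<in> between n \<beta> \<alpha>" "1 \<le> i" "i \<le> j" "j \<le> n"
  then show "\<gamma> j \<le> \<gamma> i" by (intro antimono_from_steps[of i j \<gamma>]) (auto simp: between_def)
qed

lemma jt_det_0:
  assumes "decreasing n \<alpha>" "decreasing n \<beta>" "\<And>j. 1 \<le> j \<Longrightarrow> j \<le> n \<Longrightarrow> \<beta> j \<le> \<alpha> j"
  shows "jt_det x t n 0 \<alpha> \<beta> = (if \<forall>j\<in>{1..n}. \<alpha> j = \<beta> j then 1 else 0)"
proof -
  have "{1..n} = Suc ` {..<n}" by (simp add: image_Suc_lessThan)
  then have *: "(\<forall>i<n. int (\<alpha> (Suc i)) = int (\<beta> (Suc i))) \<longleftrightarrow> (\<forall>j\<in>{1..n}. \<alpha> j = \<beta> j)"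
    by auto
  show ?thesis unfolding jt_det_def
    by (subst det_entry_no_variables, unfold *) (use assms in \<open>auto simp: decreasing_def\<close>)
qed

text \<open>In the expansion into decreasing sequences, a sequence that falls below \<open>\<beta>\<close> somewhere has
determinant zero, which leaves the shapes that contain \<open>\<beta>\<close>; in particular all remaining column
lengths are natural numbers.\<close>

lemma jt_det_Suc:
  assumes "decreasing n \<alpha>" "decreasing n \<beta>"
  shows "jt_det x t n (Suc N) \<alpha> \<beta> =
    (\<Sum>\<gamma>\<in>between n \<beta> \<alpha>. (\<Prod>j = 1..n. layer_weight (x (Suc N)) t (int (\<gamma> j)) (int (\<alpha> j))) *
       jt_det x t n N \<gamma> \<beta>)"
proof -
  let ?a = "\<lambda>i. int (\<alpha> (Suc i))" and ?b = "\<lambda>i. int (\<beta> (Suc i))"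
  let ?F = "decreasing_from 0 n (- int n) ?a"
  let ?G = "\<lambda>f. (\<Prod>i = 0..<n. layer_weight (x (Suc N)) t (f i) (?a i)) *
    det (mat n n (\<lambda>(i, j). entry x t (- int n) N ?b i (f i) j))"
  have "jt_det x t n (Suc N) \<alpha> \<beta> = (\<Sum>f\<in>?F. ?G f)"
    unfolding jt_det_def
    by (subst det_layer_rows[of n _ "- int n" _ 0]) (use assms in \<open>auto simp: decreasing_def\<close>)
  also have "\<dots> = (\<Sum>f\<in>{f\<in>?F. \<forall>i<n. ?b i \<le> f i}. ?G f)"
  proof (rule sum.mono_neutral_right)
    show "\<forall>f\<in>?F - {f\<in>?F. \<forall>i<n. ?b i \<le> f i}. ?G f = 0"
    proof
      fix f assume "f \<in> ?F - {f\<in>?F. \<forall>i<n. ?b i \<le> f i}"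
      then obtain i where f: "f \<in> ?F" and i: "i < n" "f i < ?b i" by force
      have "f p \<le> f i" if "i \<le> p" "p < n" for p
        using that f by (intro antimono_from_steps[of i p]) (auto simp: decreasing_from_def)
      moreover have "?b i \<le> ?b q" if "q \<le> i" for q
        using that assms(2) i by (auto simp: decreasing_def)
      ultimately have "det (mat n n (\<lambda>(i, j). entry x t (- int n) N ?b i (f i) j)) = 0"
        by (intro det_entry_not_contained[of i] i)
      then show "?G f = 0" by simp
    qed
  qed (auto simp: finite_decreasing_from)
  also have "\<dots> = (\<Sum>\<gamma>\<in>between n \<beta> \<alpha>.
      (\<Prod>j = 1..n. layer_weight (x (Suc N)) t (int (\<gamma> j)) (int (\<alpha> j))) * jt_det x t n N \<gamma> \<beta>)"
  \<comment> \<open>from integer sequences indexed from 0 to natural column lengths indexed from 1\<close>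
  proof (rule sum.reindex_bij_witness[
        where i = "\<lambda>\<gamma>. \<lambda>i\<in>{0..<n}. int (\<gamma> (Suc i))" and j = "\<lambda>f. \<lambda>j\<in>{1..n}. nat (f (j - 1))"], goal_cases)
    case (1 f)
    have "0 \<le> f i" if "i < n" for i
    proof -
      have "?b i \<le> f i" using 1 that by blast
      then show ?thesis by linarith
    qed
    moreover have "f \<in> extensional {0..<n}" using 1 by (simp add: decreasing_from_def PiE_iff)
    ultimately show ?case by (auto simp: fun_eq_iff extensional_def)
  next
    case (2 f)
    have "nat (f (j - Suc 0)) \<le> \<alpha> j \<and> \<beta> j \<le> nat (f (j - Suc 0))" if "1 \<le> j" "j \<le> n" for j
    proof -
      have j: "j - 1 < n" "Suc (j - 1) = j" using that by auto
      have "f (j - 1) \<le> ?a (j - 1) \<and> ?b (j - 1) \<le> f (j - 1)"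
        using 2 j(1) by (simp add: decreasing_from_def PiE_iff)
      then have "f (j - 1) \<le> int (\<alpha> j) \<and> int (\<beta> j) \<le> f (j - 1)" unfolding j(2) .
      then show ?thesis by simp linarith
    qed
    moreover have "nat (f j) \<le> nat (f (j - Suc 0))" if "1 \<le> j" "j < n" for j
    proof -
      have j: "Suc (j - 1) = j" using that by auto
      have "f (Suc (j - 1)) \<le> f (j - 1)" using 2 that j unfolding decreasing_from_def
        by (metis (mono_tags, lifting) le0 mem_Collect_eq)
      then show ?thesis using j by (intro nat_mono) simp
    qed
    ultimately show ?case
      by (auto simp: between_def PiE_iff)
  next
    case (3 \<gamma>)
    then show ?case by (auto simp: fun_eq_iff between_def PiE_iff extensional_def)
  next
    case (4 \<gamma>)
    then show ?case by (auto simp: decreasing_from_def between_def PiE_iff)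
  next
    case (5 f)
    have f: "0 \<le> f i" if "i < n" for i
    proof -
      have "?b i \<le> f i" using 5 that by blast
      then show ?thesis by linarith
    qed
    have "(\<Prod>i = 0..<n. layer_weight (x (Suc N)) t (f i) (?a i)) =
        (\<Prod>j = 1..n. layer_weight (x (Suc N)) t (int ((\<lambda>j\<in>{1..n}. nat (f (j - 1))) j)) (int (\<alpha> j)))"
      by (rule prod.reindex_bij_witness[where i = "\<lambda>j. j - 1" and j = Suc]) (auto simp: f)
    moreover have "jt_det x t n N (\<lambda>j\<in>{1..n}. nat (f (j - 1))) \<beta> =
        det (mat n n (\<lambda>(i, j). entry x t (- int n) N ?b i (f i) j))"
      unfolding jt_det_def by (intro arg_cong[of _ _ det] cong_mat) (auto simp: f)
    ultimately show ?case by simp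
  qed
  finally show ?thesis .
qed

section \<open>Reverse plane partitions with bounded entries\<close>

definition cells :: "nat \<Rightarrow> (nat \<Rightarrow> nat) \<Rightarrow> (nat \<Rightarrow> nat) \<Rightarrow> (nat \<times> nat) set" where
  "cells n \<beta> \<alpha> = {(r, j). 1 \<le> j \<and> j \<le> n \<and> \<beta> j < r \<and> r \<le> \<alpha> j}"

definition bounded_rpp :: "nat \<Rightarrow> (nat \<times> nat) set \<Rightarrow> (nat \<times> nat \<Rightarrow> nat) set" where
  "bounded_rpp N D = {R \<in> D \<rightarrow>\<^sub>E {1..N}.
     (\<forall>i j. (i, j) \<in> D \<and> (i, j + 1) \<in> D \<longrightarrow> R (i, j) \<le> R (i, j + 1)) \<and>
     (\<forall>i j. (i, j) \<in> D \<and> (i + 1, j) \<in> D \<longrightarrow> R (i, j) \<le> R (i + 1, j))}"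

text \<open>The weight of a reverse plane partition is a product over cells. A cell whose lower neighbour has
the same entry contributes its \<open>t\<close> variable; every other cell is the last one with its entry in its
column and thus accounts for the contribution of this column to the exponent of \<open>x\<^sub>v\<close>, \<open>v\<close> being the entry.\<close>

definition cell_weight ::
    "(nat \<Rightarrow> 'a) \<Rightarrow> (int \<Rightarrow> 'a) \<Rightarrow> (nat \<times> nat) set \<Rightarrow> (nat \<times> nat \<Rightarrow> nat) \<Rightarrow> nat \<times> nat \<Rightarrow> 'a" where
  "cell_weight x t D R = (\<lambda>(r, j).
     if (r + 1, j) \<in> D \<and> R (r, j) = R (r + 1, j) then t (int r) else x (R (r, j)))"

definition rpp_sum ::
    "(nat \<Rightarrow> 'a :: comm_ring_1) \<Rightarrow> (int \<Rightarrow> 'a) \<Rightarrow> nat \<Rightarrow> (nat \<times> nat) set \<Rightarrow> 'a" where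
  "rpp_sum x t N D = (\<Sum>R\<in>bounded_rpp N D. \<Prod>c\<in>D. cell_weight x t D R c)"

lemma cells_iff: "(r, j) \<in> cells n \<beta> \<alpha> \<longleftrightarrow> 1 \<le> j \<and> j \<le> n \<and> \<beta> j < r \<and> r \<le> \<alpha> j"
  by (simp add: cells_def)

lemma cells_eq_image: "cells n \<beta> \<alpha> = prod.swap ` (SIGMA j:{1..n}. {\<beta> j<..\<alpha> j})"
  by (force simp: cells_def)

lemma finite_cells: "finite (cells n \<beta> \<alpha>)"
  unfolding cells_eq_image by auto

lemma column_mono:
  assumes col: "\<And>i j. (i, j) \<in> cells n \<beta> \<alpha> \<Longrightarrow> (i + 1, j) \<in> cells n \<beta> \<alpha> \<Longrightarrow> R (i, j) \<le> (R (i + 1, j) :: nat)"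
    and rs: "(r, j) \<in> cells n \<beta> \<alpha>" "(s, j) \<in> cells n \<beta> \<alpha>" "r \<le> s"
  shows "R (r, j) \<le> R (s, j)"
  using rs(3,2)
proof (induction s rule: dec_induct)
  case (step m)
  then have "(m, j) \<in> cells n \<beta> \<alpha>" using rs(1) by (auto simp: cells_iff)
  moreover from this step.prems have "R (m, j) \<le> R (Suc m, j)" using col[of m j] by simp
  ultimately show ?case using step.IH by simp
qed simp

lemma bounded_rpp_column_mono:
  assumes "R \<in> bounded_rpp N (cells n \<beta> \<alpha>)" "(r, j) \<in> cells n \<beta> \<alpha>" "(s, j) \<in> cells n \<beta> \<alpha>" "r \<le> s"
  shows "R (r, j) \<le> R (s, j)"
  by (rule column_mono[OF _ assms(2-)]) (use assms(1) in \<open>auto simp: bounded_rpp_def\<close>)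

text \<open>The column lengths of the part of \<open>R\<close> with entries at most \<open>N\<close>. If a column has no such entry,
the inserted \<open>\<beta> j\<close> is the maximum.\<close>

definition lower_shape ::
    "nat \<Rightarrow> (nat \<Rightarrow> nat) \<Rightarrow> (nat \<Rightarrow> nat) \<Rightarrow> nat \<Rightarrow> (nat \<times> nat \<Rightarrow> nat) \<Rightarrow> nat \<Rightarrow> nat" where
  "lower_shape n \<beta> \<alpha> N R =
    (\<lambda>j\<in>{1..n}. Max (insert (\<beta> j) {r. \<beta> j < r \<and> r \<le> \<alpha> j \<and> R (r, j) \<le> N}))"

lemma lower_shape_eqI:
  assumes "\<gamma> \<in> extensional {1..n}"
    and "\<And>j. 1 \<le> j \<Longrightarrow> j \<le> n \<Longrightarrow> \<beta> j \<le> \<gamma> j \<and> \<gamma> j \<le> \<alpha> j"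
    and "\<And>r j. (r, j) \<in> cells n \<beta> \<alpha> \<Longrightarrow> R (r, j) \<le> N \<longleftrightarrow> r \<le> \<gamma> j"
  shows "lower_shape n \<beta> \<alpha> N R = \<gamma>"
proof
  fix j
  show "lower_shape n \<beta> \<alpha> N R j = \<gamma> j"
  proof (cases "j \<in> {1..n}")
    case True
    then have j: "\<beta> j \<le> \<gamma> j" "\<gamma> j \<le> \<alpha> j" using assms(2) by auto
    have S: "{r. \<beta> j < r \<and> r \<le> \<alpha> j \<and> R (r, j) \<le> N} = {\<beta> j<..\<gamma> j}"
    proof (rule Set.set_eqI)
      fix r
      show "r \<in> {r. \<beta> j < r \<and> r \<le> \<alpha> j \<and> R (r, j) \<le> N} \<longleftrightarrow> r \<in> {\<beta> j<..\<gamma> j}"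
        using assms(3)[of r j] True j by (auto simp: cells_iff)
    qed
    have "insert (\<beta> j) {\<beta> j<..\<gamma> j} = {\<beta> j..\<gamma> j}" using j by auto
    moreover have "Max {\<beta> j..\<gamma> j} = \<gamma> j" using j by (intro Max_eqI) auto
    ultimately show ?thesis using True by (simp only: lower_shape_def restrict_apply' S)
  qed (use assms(1) in \<open>auto simp: lower_shape_def extensional_def\<close>)
qed

lemma lower_shape_bounds:
  assumes "\<beta> j \<le> \<alpha> j" "1 \<le> j" "j \<le> n"
  shows "\<beta> j \<le> lower_shape n \<beta> \<alpha> N R j \<and> lower_shape n \<beta> \<alpha> N R j \<le> \<alpha> j"
proof -
  have "finite {r. \<beta> j < r \<and> r \<le> \<alpha> j \<and> R (r, j) \<le> N}"
    by (rule finite_subset[of _ "{..\<alpha> j}"]) auto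
  then show ?thesis using assms by (auto simp: lower_shape_def intro: Max_ge)
qed

lemma lower_shape_iff:
  assumes R: "R \<in> bounded_rpp M (cells n \<beta> \<alpha>)" and c: "(r, j) \<in> cells n \<beta> \<alpha>"
  shows "R (r, j) \<le> N \<longleftrightarrow> r \<le> lower_shape n \<beta> \<alpha> N R j"
proof -
  let ?S = "{r. \<beta> j < r \<and> r \<le> \<alpha> j \<and> R (r, j) \<le> N}"
  have fin: "finite ?S" by (rule finite_subset[of _ "{..\<alpha> j}"]) auto
  have m: "lower_shape n \<beta> \<alpha> N R j = Max (insert (\<beta> j) ?S)"
    using c by (simp add: lower_shape_def cells_iff)
  show ?thesis
  proof
    assume "R (r, j) \<le> N"
    then show "r \<le> lower_shape n \<beta> \<alpha> N R j"
      unfolding m using fin c by (intro Max_ge) (auto simp: cells_iff)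
  next
    assume le: "r \<le> lower_shape n \<beta> \<alpha> N R j"
    have "Max (insert (\<beta> j) ?S) \<in> insert (\<beta> j) ?S" using fin by (intro Max_in) auto
    moreover have "Max (insert (\<beta> j) ?S) \<noteq> \<beta> j" using le c unfolding m by (auto simp: cells_iff)
    ultimately have max: "lower_shape n \<beta> \<alpha> N R j \<in> ?S" unfolding m by blast
    then have "(lower_shape n \<beta> \<alpha> N R j, j) \<in> cells n \<beta> \<alpha>"
      using c by (simp add: cells_iff)
    from bounded_rpp_column_mono[OF R c this le] max show "R (r, j) \<le> N" by simp
  qed
qed

text \<open>The small entries form a skew shape because of the rows: if column \<open>j + 1\<close> reached down to a row
\<open>r\<close> below the end of column \<open>j\<close>, then the entry at \<open>(r, j)\<close> would be larger than \<open>N\<close> and its right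
neighbour at most \<open>N\<close>.\<close>

lemma lower_shape_between:
  assumes "decreasing n \<alpha>" "decreasing n \<beta>" "\<And>j. 1 \<le> j \<Longrightarrow> j \<le> n \<Longrightarrow> \<beta> j \<le> \<alpha> j"
    and R: "R \<in> bounded_rpp M (cells n \<beta> \<alpha>)"
  shows "lower_shape n \<beta> \<alpha> N R \<in> between n \<beta> \<alpha>"
proof -
  let ?\<gamma> = "lower_shape n \<beta> \<alpha> N R"
  have b: "\<beta> j \<le> ?\<gamma> j" "?\<gamma> j \<le> \<alpha> j" if "1 \<le> j" "j \<le> n" for j
    using lower_shape_bounds[of \<beta> j \<alpha>, OF assms(3)[OF that] that] by auto
  have "?\<gamma> (Suc j) \<le> ?\<gamma> j" if j: "1 \<le> j" "j < n" for j
  proof (rule ccontr)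
    assume "\<not> ?\<gamma> (Suc j) \<le> ?\<gamma> j"
    moreover define r where "r = ?\<gamma> (Suc j)"
    ultimately have r: "?\<gamma> j < r" by simp
    have "\<alpha> (Suc j) \<le> \<alpha> j" "\<beta> (Suc j) \<le> \<beta> j" using assms(1,2) j by (auto simp: decreasing_def)
    then have c: "(r, j) \<in> cells n \<beta> \<alpha>" "(r, Suc j) \<in> cells n \<beta> \<alpha>"
      using r j b[of j] b[of "Suc j"] by (auto simp: cells_iff r_def)
    then have "R (r, j) \<le> R (r, Suc j)" using R by (auto simp: bounded_rpp_def)
    also have "\<dots> \<le> N" using lower_shape_iff[OF R c(2), of N] by (simp add: r_def)
    finally show False using lower_shape_iff[OF R c(1), of N] r by simp
  qed
  then show ?thesis using b by (auto simp: between_def PiE_iff lower_shape_def)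
qed

definition add_layer ::
    "nat \<Rightarrow> (nat \<Rightarrow> nat) \<Rightarrow> (nat \<Rightarrow> nat) \<Rightarrow> nat \<Rightarrow> (nat \<Rightarrow> nat) \<Rightarrow> (nat \<times> nat \<Rightarrow> nat) \<Rightarrow> nat \<times> nat \<Rightarrow> nat" where
  "add_layer n \<beta> \<alpha> v \<gamma> R = (\<lambda>(r, j)\<in>cells n \<beta> \<alpha>. if r \<le> \<gamma> j then R (r, j) else v)"

lemma add_layer_bounded_rpp:
  assumes "decreasing n \<gamma>" "R \<in> bounded_rpp N (cells n \<beta> \<gamma>)"
  shows "add_layer n \<beta> \<alpha> (Suc N) \<gamma> R \<in> bounded_rpp (Suc N) (cells n \<beta> \<alpha>)"
proof -
  have val: "1 \<le> R (r, j) \<and> R (r, j) \<le> N" if "(r, j) \<in> cells n \<beta> \<alpha>" "r \<le> \<gamma> j" for r j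
  proof -
    have "(r, j) \<in> cells n \<beta> \<gamma>" using that by (simp add: cells_iff)
    with assms(2) show ?thesis by (auto simp: bounded_rpp_def PiE_iff)
  qed
  have row: "add_layer n \<beta> \<alpha> (Suc N) \<gamma> R (i, j) \<le> add_layer n \<beta> \<alpha> (Suc N) \<gamma> R (i, Suc j)"
    if c: "(i, j) \<in> cells n \<beta> \<alpha>" "(i, Suc j) \<in> cells n \<beta> \<alpha>" for i j
  proof (cases "i \<le> \<gamma> (Suc j)")
    case True
    moreover have "\<gamma> (Suc j) \<le> \<gamma> j" using assms(1) c by (auto simp: decreasing_def cells_iff)
    ultimately have le: "i \<le> \<gamma> j" by simp
    with True c have "(i, j) \<in> cells n \<beta> \<gamma>" "(i, Suc j) \<in> cells n \<beta> \<gamma>" by (auto simp: cells_iff)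
    with assms(2) have "R (i, j) \<le> R (i, Suc j)" by (auto simp: bounded_rpp_def)
    with True le c show ?thesis by (simp add: add_layer_def)
  next
    case False
    with c val[of i j] show ?thesis by (auto simp: add_layer_def)
  qed
  have col: "add_layer n \<beta> \<alpha> (Suc N) \<gamma> R (i, j) \<le> add_layer n \<beta> \<alpha> (Suc N) \<gamma> R (Suc i, j)"
    if c: "(i, j) \<in> cells n \<beta> \<alpha>" "(Suc i, j) \<in> cells n \<beta> \<alpha>" for i j
  proof (cases "Suc i \<le> \<gamma> j")
    case True
    with c have "(i, j) \<in> cells n \<beta> \<gamma>" "(Suc i, j) \<in> cells n \<beta> \<gamma>" by (auto simp: cells_iff)
    with assms(2) have "R (i, j) \<le> R (Suc i, j)" by (auto simp: bounded_rpp_def)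
    with True c show ?thesis by (simp add: add_layer_def)
  next
    case False
    with c val[of i j] show ?thesis by (auto simp: add_layer_def)
  qed
  have "add_layer n \<beta> \<alpha> (Suc N) \<gamma> R \<in> cells n \<beta> \<alpha> \<rightarrow>\<^sub>E {1..Suc N}"
    using val by (fastforce simp: add_layer_def)
  with row col show ?thesis by (simp add: bounded_rpp_def)
qed

lemma restrict_bounded_rpp:
  assumes "R \<in> bounded_rpp M (cells n \<beta> \<alpha>)" "cells n \<beta> \<gamma> \<subseteq> cells n \<beta> \<alpha>"
    and "\<And>r j. (r, j) \<in> cells n \<beta> \<gamma> \<Longrightarrow> R (r, j) \<le> N"
  shows "restrict R (cells n \<beta> \<gamma>) \<in> bounded_rpp N (cells n \<beta> \<gamma>)"
  using assms by (fastforce simp: bounded_rpp_def PiE_iff)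

lemma layer_weight_column:
  assumes "g \<le> a"
  shows "(\<Prod>r\<in>{g<..a}. if r < a then t (int r) else y) = layer_weight y t (int g) (int a)"
proof (cases "g = a")
  case False
  with assms have "{g<..a} = insert a {g<..<a}" by auto
  moreover have "(\<Prod>l\<in>{int g<..<int a}. t l) = (\<Prod>r\<in>{g<..<a}. t (int r))"
    by (rule prod.reindex_bij_witness[where i = int and j = nat]) auto
  ultimately show ?thesis using False by (simp add: layer_weight_def)
qed (simp add: layer_weight_def)

text \<open>The cells with the largest entry \<open>N + 1\<close> fill the lower end of every column, so each of
them except the last one in its column contributes its \<open>t\<close> variable. For a cell with a
smaller entry the lower neighbour has the same entry only if it belongs to the smaller shape, too.\<close>

lemma weight_add_layer:
  fixes x :: "nat \<Rightarrow> 'a :: comm_ring_1"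
  assumes R: "R \<in> bounded_rpp (Suc N) (cells n \<beta> \<alpha>)"
    and \<gamma>: "\<And>j. 1 \<le> j \<Longrightarrow> j \<le> n \<Longrightarrow> \<beta> j \<le> \<gamma> j \<and> \<gamma> j \<le> \<alpha> j"
    and split: "\<And>r j. (r, j) \<in> cells n \<beta> \<alpha> \<Longrightarrow> R (r, j) \<le> N \<longleftrightarrow> r \<le> \<gamma> j"
  shows "(\<Prod>c\<in>cells n \<beta> \<alpha>. cell_weight x t (cells n \<beta> \<alpha>) R c) =
    (\<Prod>j = 1..n. layer_weight (x (Suc N)) t (int (\<gamma> j)) (int (\<alpha> j))) *
    (\<Prod>c\<in>cells n \<beta> \<gamma>. cell_weight x t (cells n \<beta> \<gamma>) (restrict R (cells n \<beta> \<gamma>)) c)"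
proof -
  let ?w = "cell_weight x t (cells n \<beta> \<alpha>) R"
  have top: "R (r, j) = Suc N" if "(r, j) \<in> cells n \<beta> \<alpha>" "\<gamma> j < r" for r j
  proof -
    have "R (r, j) \<le> Suc N" using R that(1) by (auto simp: bounded_rpp_def PiE_iff)
    moreover have "\<not> R (r, j) \<le> N" using split[OF that(1)] that(2) by simp
    ultimately show ?thesis by simp
  qed
  have un: "cells n \<beta> \<alpha> = cells n \<gamma> \<alpha> \<union> cells n \<beta> \<gamma>" "cells n \<gamma> \<alpha> \<inter> cells n \<beta> \<gamma> = {}"
    using \<gamma> by (fastforce simp: cells_iff)+
  have "(\<Prod>c\<in>cells n \<beta> \<alpha>. ?w c) = (\<Prod>c\<in>cells n \<gamma> \<alpha>. ?w c) * (\<Prod>c\<in>cells n \<beta> \<gamma>. ?w c)"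
    by (subst un(1), rule prod.union_disjoint) (auto simp: finite_cells un(2))
  also have "(\<Prod>c\<in>cells n \<gamma> \<alpha>. ?w c) =
      (\<Prod>(j, r)\<in>(SIGMA j:{1..n}. {\<gamma> j<..\<alpha> j}). if r < \<alpha> j then t (int r) else x (Suc N))"
    unfolding cells_eq_image[of n \<gamma> \<alpha>]
  proof (subst prod.reindex)
    show "(\<Prod>c\<in>(SIGMA j:{1..n}. {\<gamma> j<..\<alpha> j}). (?w \<circ> prod.swap) c) =
        (\<Prod>(j, r)\<in>(SIGMA j:{1..n}. {\<gamma> j<..\<alpha> j}). if r < \<alpha> j then t (int r) else x (Suc N))"
    proof (intro prod.cong refl, clarify)
      fix j r assume jr: "j \<in> {1..n}" "r \<in> {\<gamma> j<..\<alpha> j}"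
      then have c: "(r, j) \<in> cells n \<beta> \<alpha>" using \<gamma>[of j] by (auto simp: cells_iff)
      have "R (Suc r, j) = Suc N" if "r < \<alpha> j"
        using that c jr by (intro top) (auto simp: cells_iff)
      moreover have "(Suc r, j) \<in> cells n \<beta> \<alpha> \<longleftrightarrow> r < \<alpha> j" using c by (auto simp: cells_iff)
      ultimately show "(?w \<circ> prod.swap) (j, r) = (if r < \<alpha> j then t (int r) else x (Suc N))"
        using top[OF c] jr by (auto simp: cell_weight_def)
    qed
  qed auto
  also have "\<dots> = (\<Prod>j = 1..n. layer_weight (x (Suc N)) t (int (\<gamma> j)) (int (\<alpha> j)))"
    by (subst prod.Sigma [symmetric]) (auto intro!: prod.cong layer_weight_column simp: \<gamma>)
  also have "(\<Prod>c\<in>cells n \<beta> \<gamma>. ?w c) =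
      (\<Prod>c\<in>cells n \<beta> \<gamma>. cell_weight x t (cells n \<beta> \<gamma>) (restrict R (cells n \<beta> \<gamma>)) c)"
  proof (intro prod.cong refl, clarify)
    fix r j assume c: "(r, j) \<in> cells n \<beta> \<gamma>"
    then have c': "(r, j) \<in> cells n \<beta> \<alpha>" using un(1) by blast
    have "R (r, j) \<noteq> R (Suc r, j)" if "(Suc r, j) \<in> cells n \<beta> \<alpha>" "(Suc r, j) \<notin> cells n \<beta> \<gamma>"
      using split[OF c'] split[OF that(1)] c that by (auto simp: cells_iff)
    then show "?w (r, j) = cell_weight x t (cells n \<beta> \<gamma>) (restrict R (cells n \<beta> \<gamma>)) (r, j)"
      using c un(1) by (auto simp: cell_weight_def)
  qed
  finally show ?thesis .
qed

lemma finite_between: "finite (between n \<beta> \<alpha>)"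
proof (rule finite_subset)
  show "between n \<beta> \<alpha> \<subseteq> (\<Pi>\<^sub>E j\<in>{1..n}. {\<beta> j..\<alpha> j})" by (auto simp: between_def)
qed (intro finite_PiE, auto)

lemma finite_bounded_rpp: "finite D \<Longrightarrow> finite (bounded_rpp N D)"
  by (rule finite_subset[of _ "D \<rightarrow>\<^sub>E {1..N}"]) (auto simp: bounded_rpp_def intro!: finite_PiE)

text \<open>Removing all entries \<open>N + 1\<close> is a bijection onto pairs of a shape between \<open>\<beta>\<close> and \<open>\<alpha>\<close> and a
reverse plane partition of this shape: the removed entries are equal to each other and larger than
all others, so they satisfy the row and column conditions whatever the intermediate shape is.\<close>

lemma rpp_sum_Suc:
  fixes x :: "nat \<Rightarrow> 'a :: comm_ring_1"
  assumes "decreasing n \<alpha>" "decreasing n \<beta>" "\<And>j. 1 \<le> j \<Longrightarrow> j \<le> n \<Longrightarrow> \<beta> j \<le> \<alpha> j"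
  shows "rpp_sum x t (Suc N) (cells n \<beta> \<alpha>) =
    (\<Sum>\<gamma>\<in>between n \<beta> \<alpha>. (\<Prod>j = 1..n. layer_weight (x (Suc N)) t (int (\<gamma> j)) (int (\<alpha> j))) *
       rpp_sum x t N (cells n \<beta> \<gamma>))"
proof -
  let ?w = "\<lambda>\<alpha> R. \<Prod>c\<in>cells n \<beta> \<alpha>. cell_weight x t (cells n \<beta> \<alpha>) R c"
  let ?l = "\<lambda>\<gamma>. \<Prod>j = 1..n. layer_weight (x (Suc N)) t (int (\<gamma> j)) (int (\<alpha> j))"
  let ?low = "lower_shape n \<beta> \<alpha> N"
  have sub: "cells n \<beta> \<gamma> \<subseteq> cells n \<beta> \<alpha>" if "\<gamma> \<in> between n \<beta> \<alpha>" for \<gamma>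
  proof clarify
    fix r j assume c: "(r, j) \<in> cells n \<beta> \<gamma>"
    then have "\<gamma> j \<le> \<alpha> j" using that by (auto simp: cells_iff between_def PiE_iff)
    with c show "(r, j) \<in> cells n \<beta> \<alpha>" by (simp add: cells_iff)
  qed
  have low: "?low R \<in> between n \<beta> \<alpha>" if "R \<in> bounded_rpp (Suc N) (cells n \<beta> \<alpha>)" for R
    by (rule lower_shape_between[OF assms that])
  have add: "?low (add_layer n \<beta> \<alpha> (Suc N) \<gamma> R) = \<gamma>"
    if "\<gamma> \<in> between n \<beta> \<alpha>" "R \<in> bounded_rpp N (cells n \<beta> \<gamma>)" for \<gamma> R
  proof (rule lower_shape_eqI)
    fix r j assume c: "(r, j) \<in> cells n \<beta> \<alpha>"
    have "R (r, j) \<le> N" if "r \<le> \<gamma> j"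
    proof -
      have "(r, j) \<in> cells n \<beta> \<gamma>" using c that by (simp add: cells_iff)
      with \<open>R \<in> _\<close> show ?thesis by (auto simp: bounded_rpp_def PiE_iff)
    qed
    with c show "add_layer n \<beta> \<alpha> (Suc N) \<gamma> R (r, j) \<le> N \<longleftrightarrow> r \<le> \<gamma> j"
      by (auto simp: add_layer_def)
  qed (use that(1) in \<open>auto simp: between_def PiE_iff\<close>)
  have "rpp_sum x t (Suc N) (cells n \<beta> \<alpha>) =
      (\<Sum>(\<gamma>, R)\<in>(SIGMA \<gamma>:between n \<beta> \<alpha>. bounded_rpp N (cells n \<beta> \<gamma>)). ?l \<gamma> * ?w \<gamma> R)"
    unfolding rpp_sum_def
  proof (rule sum.reindex_bij_witness[where i = "\<lambda>(\<gamma>, R). add_layer n \<beta> \<alpha> (Suc N) \<gamma> R"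
        and j = "\<lambda>R. (?low R, restrict R (cells n \<beta> (?low R)))"], goal_cases)
    case (1 R)
    have "add_layer n \<beta> \<alpha> (Suc N) (?low R) (restrict R (cells n \<beta> (?low R))) c = R c" for c
    proof (cases "c \<in> cells n \<beta> \<alpha>")
      case True
      obtain r j where c: "c = (r, j)" by force
      show ?thesis
      proof (cases "r \<le> ?low R j")
        case True
        with \<open>c \<in> _\<close> show ?thesis by (simp add: c add_layer_def cells_iff)
      next
        case False
        then have "R (r, j) = Suc N"
          using lower_shape_iff[OF 1, of r j N] 1 \<open>c \<in> _\<close>
          by (auto simp: c bounded_rpp_def PiE_iff le_Suc_eq)
        with False \<open>c \<in> _\<close> show ?thesis by (simp add: c add_layer_def)
      qed
    next
      case False
      with 1 show ?thesis by (cases c) (auto simp: add_layer_def bounded_rpp_def PiE_iff extensional_def)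
    qed
    then show ?case by auto
  next
    case (2 R)
    have "restrict R (cells n \<beta> (?low R)) \<in> bounded_rpp N (cells n \<beta> (?low R))"
    proof (rule restrict_bounded_rpp[OF 2 sub[OF low[OF 2]]])
      fix r j assume "(r, j) \<in> cells n \<beta> (?low R)"
      moreover from this have "(r, j) \<in> cells n \<beta> \<alpha>" using sub[OF low[OF 2]] by blast
      ultimately show "R (r, j) \<le> N" using lower_shape_iff[OF 2] by (simp add: cells_iff)
    qed
    with low[OF 2] show ?case by simp
  next
    case (3 b)
    then obtain \<gamma> R where b: "b = (\<gamma>, R)" and \<gamma>: "\<gamma> \<in> between n \<beta> \<alpha>"
      and R: "R \<in> bounded_rpp N (cells n \<beta> \<gamma>)" by auto
    have "restrict (add_layer n \<beta> \<alpha> (Suc N) \<gamma> R) (cells n \<beta> \<gamma>) c = R c" for c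
    proof (cases "c \<in> cells n \<beta> \<gamma>")
      case True
      moreover have "c \<in> cells n \<beta> \<alpha>" using True sub[OF \<gamma>] by blast
      ultimately show ?thesis by (cases c) (simp add: add_layer_def cells_iff)
    next
      case False
      with R show ?thesis by (cases c) (auto simp: bounded_rpp_def PiE_iff extensional_def)
    qed
    then show ?case by (auto simp: b add[OF \<gamma> R])
  next
    case (4 b)
    then show ?case by (auto intro: add_layer_bounded_rpp between_decreasing)
  next
    case (5 R)
    show ?case unfolding prod.case
    proof (rule weight_add_layer[OF 5, symmetric])
      show "\<beta> j \<le> ?low R j \<and> ?low R j \<le> \<alpha> j" if "1 \<le> j" "j \<le> n" for j
        by (rule lower_shape_bounds[of \<beta> j \<alpha>, OF assms(3)[OF that] that])
    qed (rule lower_shape_iff[OF 5])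
  qed
  also have "\<dots> = (\<Sum>\<gamma>\<in>between n \<beta> \<alpha>. \<Sum>R\<in>bounded_rpp N (cells n \<beta> \<gamma>). ?l \<gamma> * ?w \<gamma> R)"
    by (rule sum.Sigma [symmetric]) (auto simp: finite_between finite_bounded_rpp finite_cells)
  finally show ?thesis by (simp add: rpp_sum_def sum_distrib_left)
qed

lemma rpp_sum_0:
  assumes "\<And>j. 1 \<le> j \<Longrightarrow> j \<le> n \<Longrightarrow> \<beta> j \<le> \<alpha> j"
  shows "rpp_sum x t 0 (cells n \<beta> \<alpha>) = (if \<forall>j\<in>{1..n}. \<alpha> j = \<beta> j then 1 else 0)"
proof (cases "\<forall>j\<in>{1..n}. \<alpha> j = \<beta> j")
  case True
  then have "cells n \<beta> \<alpha> = {}" by (auto simp: cells_def)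
  with True show ?thesis by (simp add: rpp_sum_def bounded_rpp_def)
next
  case False
  then obtain j where "1 \<le> j" "j \<le> n" "\<alpha> j \<noteq> \<beta> j" by auto
  with assms[of j] have "(\<alpha> j, j) \<in> cells n \<beta> \<alpha>" by (simp add: cells_iff)
  then have "bounded_rpp 0 (cells n \<beta> \<alpha>) = {}" by (auto simp: bounded_rpp_def)
  with False show ?thesis by (simp add: rpp_sum_def)
qed

text \<open>Both sides satisfy the same recursion in the number of \<open>x\<close> variables, and both are 1 or 0 without
\<open>x\<close> variables, according to whether the skew shape is empty.\<close>

lemma rpp_sum_eq_jt_det:
  assumes "decreasing n \<alpha>" "decreasing n \<beta>" "\<And>j. 1 \<le> j \<Longrightarrow> j \<le> n \<Longrightarrow> \<beta> j \<le> \<alpha> j"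
  shows "rpp_sum x t N (cells n \<beta> \<alpha>) = jt_det x t n N \<alpha> \<beta>"
  using assms(1,3)
proof (induction N arbitrary: \<alpha>)
  case 0
  then show ?case using assms(2) by (simp add: rpp_sum_0 jt_det_0)
next
  case (Suc N)
  have "rpp_sum x t N (cells n \<beta> \<gamma>) = jt_det x t n N \<gamma> \<beta>" if "\<gamma> \<in> between n \<beta> \<alpha>" for \<gamma>
    using that by (intro Suc.IH between_decreasing[OF that]) (auto simp: between_def PiE_iff)
  then show ?case
    by (simp add: rpp_sum_Suc[OF Suc.prems(1) assms(2) Suc.prems(2)] jt_det_Suc[OF Suc.prems(1) assms(2)])
qed

section \<open>Restriction to finitely many \<open>x\<close> variables\<close>

text \<open>Setting all variables outside \<open>W\<close> to zero.\<close>

definition mps_restrict :: "'v set \<Rightarrow> ('v, 'a :: zero) mps \<Rightarrow> ('v, 'a) mps" where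
  "mps_restrict W f = Abs_mps (\<lambda>m. if set_mset m \<subseteq> W then mps_nth f m else 0)"

lemma mps_nth_restrict [simp]:
  "mps_nth (mps_restrict W f) m = (if set_mset m \<subseteq> W then mps_nth f m else 0)"
  by (simp add: mps_restrict_def)

lemma mps_restrict_hom: "comm_ring_hom (mps_restrict W :: ('v, 'a :: comm_ring_1) mps \<Rightarrow> _)"
proof
  fix f g :: "('v, 'a) mps"
  show "mps_restrict W (f * g) = mps_restrict W f * mps_restrict W g"
  proof (rule mps_eqI)
    fix m :: "'v multiset"
    have "mps_nth (mps_restrict W f) A * mps_nth (mps_restrict W g) (m - A) =
        (if set_mset m \<subseteq> W then mps_nth f A * mps_nth g (m - A) else 0)" if "A \<subseteq># m" for A
    proof -
      have "set_mset m = set_mset A \<union> set_mset (m - A)"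
        using that by (metis set_mset_union subset_mset.add_diff_inverse)
      then show ?thesis by auto
    qed
    then show "mps_nth (mps_restrict W (f * g)) m = mps_nth (mps_restrict W f * mps_restrict W g) m"
      by (simp add: mps_nth_times del: mps_nth_restrict) (simp add: mps_nth_times)
  qed
qed (auto intro!: mps_eqI)

lemma mps_nth_sum: "mps_nth (\<Sum>i\<in>I. f i) m = (\<Sum>i\<in>I. mps_nth (f i) m :: 'a :: comm_ring_1)"
  by (induction I rule: infinite_finite_induct) simp_all

lemma mps_nth_mps_sum_eq:
  assumes "finite J" "J \<subseteq> I" "\<And>i. i \<in> I \<Longrightarrow> i \<notin> J \<Longrightarrow> mps_nth (f i) m = 0"
  shows "mps_nth (mps_sum f I) m = (\<Sum>i\<in>J. mps_nth (f i) m)"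
  unfolding mps_sum_def mps_nth_Abs
  using assms by (intro sum.mono_neutral_left) auto

lemma prod_mps_var: "finite S \<Longrightarrow> (\<Prod>v\<in>S. mps_var v) = (mps_monom (mset_set S) :: ('v, 'a :: comm_ring_1) mps)"
  by (induction S rule: finite_induct) (simp_all add: mps_var_def flip: mps_monom_add)

text \<open>Setting variables to zero removes them from the list of variables of \<open>e\<^sub>k\<close>, and for finitely many
variables \<open>e\<^sub>k\<close> is the coefficient of \<open>z\<^sup>k\<close> in the product of all \<open>1 + v z\<close>.\<close>

lemma restrict_elem_sym:
  assumes "finite (V \<inter> W)"
  shows "mps_restrict W (elem_sym k V) = fps_at (\<Prod>v\<in>V \<inter> W. lin_factor (mps_var v)) k"
proof (cases "k < 0")
  case True
  then show ?thesis by (auto intro!: mps_eqI simp: elem_sym_def)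
next
  case False
  let ?I = "{S. S \<subseteq> V \<and> finite S \<and> card S = nat k}"
  let ?J = "{S. S \<subseteq> V \<inter> W \<and> card S = nat k}"
  have "finite (Pow (V \<inter> W))" using assms by blast
  then have J: "finite ?J" by (rule finite_subset[rotated]) auto
  have "?J \<subseteq> ?I" using finite_subset[OF _ assms] by auto
  have "mps_restrict W (elem_sym k V) = (\<Sum>S\<in>?J. \<Prod>v\<in>S. mps_var v)"
  proof (rule mps_eqI)
    fix m :: "'a multiset"
    have nth: "mps_nth (\<Prod>v\<in>S. mps_var v :: ('a, int) mps) m = (if m = mset_set S then 1 else 0)"
      if "S \<in> ?I" for S
      using that by (simp add: prod_mps_var)
    show "mps_nth (mps_restrict W (elem_sym k V)) m = mps_nth (\<Sum>S\<in>?J. \<Prod>v\<in>S. mps_var v) m"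
    proof (cases "set_mset m \<subseteq> W")
      case True
      then have "mps_nth (mps_restrict W (elem_sym k V)) m =
          mps_nth (mps_sum (\<lambda>S. \<Prod>v\<in>S. mps_var v) ?I) m"
        using False by (simp add: elem_sym_def)
      also have "\<dots> = (\<Sum>S\<in>?J. mps_nth (\<Prod>v\<in>S. mps_var v) m)"
      proof (rule mps_nth_mps_sum_eq[OF J \<open>?J \<subseteq> ?I\<close>])
        fix S assume "S \<in> ?I" "S \<notin> ?J"
        then have "m \<noteq> mset_set S" using True by auto
        with nth[OF \<open>S \<in> ?I\<close>] show "mps_nth (\<Prod>v\<in>S. mps_var v :: ('a, int) mps) m = 0" by simp
      qed
      finally show ?thesis by (simp add: mps_nth_sum)
    next
      case F: False
      have "mps_nth (\<Prod>v\<in>S. mps_var v :: ('a, int) mps) m = 0" if "S \<in> ?J" for S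
      proof -
        have "finite S" "S \<subseteq> W" using that finite_subset[OF _ assms, of S] by auto
        then have "m \<noteq> mset_set S" using F by auto
        with nth[of S] that \<open>?J \<subseteq> ?I\<close> show ?thesis by auto
      qed
      with F show ?thesis by (simp add: mps_nth_sum)
    qed
  qed
  with False show ?thesis by (simp add: fps_at_def fps_nth_prod_lin[OF assms])
qed

definition cell_var :: "(nat \<times> nat) set \<Rightarrow> (nat \<times> nat \<Rightarrow> nat) \<Rightarrow> nat \<times> nat \<Rightarrow> gvar" where
  "cell_var D R = (\<lambda>(r, j).
     if (r + 1, j) \<in> D \<and> R (r, j) = R (r + 1, j) then T r else X (R (r, j)))"

text \<open>A column that contains \<open>v\<close> has exactly one cell counted on the left, namely the lowest of its cells
with entry \<open>v\<close>: by monotonicity these cells are consecutive.\<close>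

lemma card_cells_X:
  assumes col: "\<And>i j. (i, j) \<in> cells n \<beta> \<alpha> \<Longrightarrow> (i + 1, j) \<in> cells n \<beta> \<alpha> \<Longrightarrow> R (i, j) \<le> R (i + 1, j)"
  shows "card {c \<in> cells n \<beta> \<alpha>. cell_var (cells n \<beta> \<alpha>) R c = X v} = x_exponent (cells n \<beta> \<alpha>) R v"
    (is "card ?C = _")
proof -
  let ?D = "cells n \<beta> \<alpha>"
  have C: "(r, j) \<in> ?C \<longleftrightarrow> (r, j) \<in> ?D \<and> R (r, j) = v \<and> \<not> ((Suc r, j) \<in> ?D \<and> R (Suc r, j) = v)" for r j
    by (auto simp: cell_var_def)
  have inj: "inj_on snd ?C"
  proof -
    have no: "\<not> r < s" if "(r, j) \<in> ?C" "(s, j) \<in> ?C" for r s j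
    proof
      assume "r < s"
      then have mid: "(Suc r, j) \<in> ?D" using that C by (auto simp: cells_iff)
      have r: "(r, j) \<in> ?D" "R (r, j) = v" "R (Suc r, j) \<noteq> v" and s: "(s, j) \<in> ?D" "R (s, j) = v"
        using that mid unfolding C by simp_all
      have "R (r, j) \<le> R (Suc r, j)" using r(1) mid by (intro column_mono[OF col]) auto
      moreover have "R (Suc r, j) \<le> R (s, j)"
        using s(1) mid \<open>r < s\<close> by (intro column_mono[OF col]) auto
      ultimately show False using r s by simp
    qed
    show ?thesis
    proof (rule inj_onI)
      fix c d assume cd: "c \<in> ?C" "d \<in> ?C" "snd c = snd d"
      have "fst c = fst d"
        using no[of "fst c" "snd c" "fst d"] no[of "fst d" "snd c" "fst c"] cd
        by (metis linorder_neqE_nat prod.collapse)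
      with cd(3) show "c = d" by (simp add: prod_eq_iff)
    qed
  qed
  have "snd ` ?C = {j. \<exists>r. (r, j) \<in> ?D \<and> R (r, j) = v}"
  proof (intro equalityI subsetI)
    fix j assume "j \<in> {j. \<exists>r. (r, j) \<in> ?D \<and> R (r, j) = v}"
    then obtain r0 where r0: "(r0, j) \<in> ?D" "R (r0, j) = v" by blast
    \<comment> \<open>the lowest cell with entry \<open>v\<close> in column \<open>j\<close> is the one counted in \<open>?C\<close>\<close>
    let ?S = "{r. (r, j) \<in> ?D \<and> R (r, j) = v}"
    have fin: "finite ?S" by (rule finite_subset[of _ "{..\<alpha> j}"]) (auto simp: cells_iff)
    have "Max ?S \<in> ?S" using fin r0 by (intro Max_in) auto
    moreover have "Suc (Max ?S) \<notin> ?S" using Max_ge[OF fin, of "Suc (Max ?S)"] by auto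
    ultimately have "(Max ?S, j) \<in> ?C" unfolding C by blast
    then show "j \<in> snd ` ?C" by force
  next
    fix j assume "j \<in> snd ` ?C"
    then obtain r where "(r, j) \<in> ?C" by force
    then have "(r, j) \<in> ?D \<and> R (r, j) = v" unfolding C by simp
    then show "j \<in> {j. \<exists>r. (r, j) \<in> ?D \<and> R (r, j) = v}" by blast
  qed
  then show ?thesis unfolding x_exponent_def using card_image[OF inj] by simp
qed

lemma card_cells_T:
  "card {c \<in> D. cell_var D R c = T i} = t_exponent D R i"
proof -
  have "{c \<in> D. cell_var D R c = T i} =
      Pair i ` {j. (i, j) \<in> D \<and> (i + 1, j) \<in> D \<and> R (i, j) = R (i + 1, j)}"
    by (auto simp: cell_var_def split: if_splits)
  then show ?thesis unfolding t_exponent_def by (simp add: card_image inj_on_def)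
qed

lemma count_sum_singletons:
  "finite D \<Longrightarrow> count (\<Sum>c\<in>D. {#h c#}) v = card {c \<in> D. h c = v}"
proof -
  assume D: "finite D"
  have "count (\<Sum>c\<in>D. {#h c#}) v = (\<Sum>c\<in>D. if h c = v then 1 else 0)"
    by (auto simp: count_sum intro!: sum.cong)
  then show ?thesis using D by (simp add: sum.If_cases Int_def)
qed

text \<open>The exponents count cells: the exponent of \<open>x\<^sub>v\<close> by \<open>card_cells_X\<close>, that of \<open>t\<^sub>i\<close> directly.\<close>

lemma rpp_weight_cells:
  assumes col: "\<And>i j. (i, j) \<in> cells n \<beta> \<alpha> \<Longrightarrow> (i + 1, j) \<in> cells n \<beta> \<alpha> \<Longrightarrow> R (i, j) \<le> R (i + 1, j)"
  shows "rpp_weight (cells n \<beta> \<alpha>) R = mps_monom (\<Sum>c\<in>cells n \<beta> \<alpha>. {#cell_var (cells n \<beta> \<alpha>) R c#})"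
proof -
  let ?D = "cells n \<beta> \<alpha>"
  let ?I = "R ` ?D \<union> fst ` ?D"
  have "(\<Sum>i\<in>?I. replicate_mset (x_exponent ?D R i) (X i) + replicate_mset (t_exponent ?D R i) (T i)) =
      (\<Sum>c\<in>?D. {#cell_var ?D R c#})" (is "?L = ?R")
  proof (rule multiset_eqI)
    fix v
    have I: "finite ?I" using finite_cells by auto
    show "count ?L v = count ?R v"
    proof (cases v)
      case (X i)
      have "count ?L v = (\<Sum>k\<in>?I. if k = i then x_exponent ?D R i else 0)"
        by (auto simp: count_sum X intro!: sum.cong)
      also have "\<dots> = (if i \<in> ?I then x_exponent ?D R i else 0)" using I by simp
      also have "\<dots> = card {c \<in> ?D. cell_var ?D R c = X i}"
      proof (cases "i \<in> ?I")
        case False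
        then have "{c \<in> ?D. cell_var ?D R c = X i} = {}"
          by (auto simp: cell_var_def split: if_splits)
        then show ?thesis using False by (simp only: card.empty if_False)
      next
        case True
        then show ?thesis by (simp only: if_True card_cells_X[OF col])
      qed
      finally show ?thesis by (simp add: count_sum_singletons[OF finite_cells] X)
    next
      case (T i)
      have "count ?L v = (\<Sum>k\<in>?I. if k = i then t_exponent ?D R i else 0)"
        by (auto simp: count_sum T intro!: sum.cong)
      also have "\<dots> = (if i \<in> ?I then t_exponent ?D R i else 0)" using I by simp
      also have "\<dots> = card {c \<in> ?D. cell_var ?D R c = T i}"
      proof (cases "i \<in> ?I")
        case False
        then have "{c \<in> ?D. cell_var ?D R c = T i} = {}"
          by (force simp: cell_var_def split: if_splits)
        then show ?thesis using False by (simp only: card.empty if_False)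
      qed (simp add: card_cells_T)
      finally show ?thesis by (simp add: count_sum_singletons[OF finite_cells] T)
    qed
  qed
  then show ?thesis by (simp add: rpp_weight_monom finite_cells)
qed

abbreviation vars_upto :: "nat \<Rightarrow> gvar set" where
  "vars_upto N \<equiv> X ` {..N} \<union> range T"

text \<open>The bottom cell of a column carries the largest entry of the column and has no lower neighbour, so
that this entry occurs as the index of an \<open>x\<close> variable. Setting \<open>x\<^sub>k\<close> to zero for \<open>k > N\<close> thus leaves
precisely the fillings with entries at most \<open>N\<close>.\<close>

lemma cell_vars_upto_iff:
  assumes col: "\<And>i j. (i, j) \<in> cells n \<beta> \<alpha> \<Longrightarrow> (i + 1, j) \<in> cells n \<beta> \<alpha> \<Longrightarrow> R (i, j) \<le> R (i + 1, j)"
  shows "cell_var (cells n \<beta> \<alpha>) R ` cells n \<beta> \<alpha> \<subseteq> vars_upto N \<longleftrightarrow> (\<forall>c\<in>cells n \<beta> \<alpha>. R c \<le> N)"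
    (is "?V \<longleftrightarrow> _")
proof
  let ?D = "cells n \<beta> \<alpha>"
  assume V: ?V
  show "\<forall>c\<in>?D. R c \<le> N"
  proof clarify
    fix r j assume c: "(r, j) \<in> ?D"
    then have b: "1 \<le> j" "j \<le> n" "\<beta> j < \<alpha> j" by (auto simp: cells_iff)
    then have last: "(\<alpha> j, j) \<in> ?D" "(Suc (\<alpha> j), j) \<notin> ?D" by (auto simp: cells_iff)
    then have "cell_var ?D R (\<alpha> j, j) = X (R (\<alpha> j, j))" by (simp add: cell_var_def)
    with V last(1) have "X (R (\<alpha> j, j)) \<in> vars_upto N" by (metis image_subset_iff)
    then have "R (\<alpha> j, j) \<le> N" by auto
    moreover have "R (r, j) \<le> R (\<alpha> j, j)"
      using c last(1) by (intro column_mono[OF col]) (auto simp: cells_iff)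
    ultimately show "R (r, j) \<le> N" by simp
  qed
next
  assume "\<forall>c\<in>cells n \<beta> \<alpha>. R c \<le> N"
  then show ?V by (auto simp: cell_var_def)
qed

abbreviation x_var :: "nat \<Rightarrow> (gvar, int) mps" where
  "x_var k \<equiv> mps_var (X k)"

abbreviation t_var :: "int \<Rightarrow> (gvar, int) mps" where
  "t_var l \<equiv> mps_var (T (nat l))"

lemma restrict_rpp_sum:
  assumes "skew_diagram lam mu = cells n \<beta> \<alpha>"
  shows "mps_restrict (vars_upto N) (mps_sum (rpp_weight (skew_diagram lam mu)) (RPP lam mu)) =
    rpp_sum x_var t_var N (cells n \<beta> \<alpha>)"
proof (rule mps_eqI)
  let ?D = "cells n \<beta> \<alpha>"
  let ?w = "\<lambda>R. \<Sum>c\<in>?D. {#cell_var ?D R c#}"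
  fix m :: "gvar multiset"
  have w: "rpp_weight ?D R = mps_monom (?w R)" if "R \<in> RPP lam mu" for R
    using that by (intro rpp_weight_cells) (auto simp: RPP_def assms)
  have bounded: "R \<in> bounded_rpp N ?D \<longleftrightarrow> set_mset (?w R) \<subseteq> vars_upto N" if "R \<in> RPP lam mu" for R
  proof -
    have "set_mset (?w R) = cell_var ?D R ` ?D" by (auto simp: set_mset_sum finite_cells)
    moreover have "cell_var ?D R ` ?D \<subseteq> vars_upto N \<longleftrightarrow> (\<forall>c\<in>?D. R c \<le> N)"
      using that by (intro cell_vars_upto_iff) (auto simp: RPP_def assms)
    moreover have "R \<in> bounded_rpp N ?D \<longleftrightarrow> (\<forall>c\<in>?D. R c \<le> N)"
      using that by (auto simp: RPP_def bounded_rpp_def assms PiE_iff)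
    ultimately show ?thesis by simp
  qed
  have sub: "bounded_rpp N ?D \<subseteq> RPP lam mu"
    by (auto simp: RPP_def bounded_rpp_def assms PiE_iff)
  have "(\<Prod>c\<in>?D. cell_weight x_var t_var ?D R c) = mps_monom (?w R)" for R
    unfolding mps_monom_sum by (intro prod.cong) (auto simp: cell_weight_def cell_var_def mps_var_def)
  then have rhs: "mps_nth (rpp_sum x_var t_var N ?D) m = (\<Sum>R\<in>bounded_rpp N ?D. mps_nth (mps_monom (?w R)) m)"
    by (simp add: rpp_sum_def mps_nth_sum)
  show "mps_nth (mps_restrict (vars_upto N) (mps_sum (rpp_weight (skew_diagram lam mu)) (RPP lam mu))) m =
      mps_nth (rpp_sum x_var t_var N ?D) m"
  proof (cases "set_mset m \<subseteq> vars_upto N")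
    case True
    then have "mps_nth (mps_restrict (vars_upto N) (mps_sum (rpp_weight ?D) (RPP lam mu))) m =
        mps_nth (mps_sum (rpp_weight ?D) (RPP lam mu)) m" by simp
    also have "\<dots> = (\<Sum>R\<in>bounded_rpp N ?D. mps_nth (rpp_weight ?D R) m)"
      using sub bounded w True by (intro mps_nth_mps_sum_eq) (auto simp: finite_bounded_rpp finite_cells)
    also have "\<dots> = mps_nth (rpp_sum x_var t_var N ?D) m"
      unfolding rhs using sub w by (intro sum.cong) auto
    finally show ?thesis by (simp add: assms)
  next
    case False
    have "mps_nth (mps_monom (?w R) :: (gvar, int) mps) m = 0" if "R \<in> bounded_rpp N ?D" for R
      using bounded[of R] that sub False by auto
    then have "mps_nth (rpp_sum x_var t_var N ?D) m = 0" unfolding rhs by (rule sum.neutral[rule_format])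
    with False show ?thesis by simp
  qed
qed

section \<open>The determinant formula\<close>

lemma mem_diagram_conj:
  assumes "is_partition lam"
  shows "(r, j) \<in> diagram lam \<longleftrightarrow> 1 \<le> r \<and> 1 \<le> j \<and> r \<le> part (conj_partition lam) j"
proof -
  have "(r, j) \<in> diagram lam \<longleftrightarrow> (j, r) \<in> diagram (conj_partition lam)"
    using conj_partition(2)[OF assms] by auto
  also have "\<dots> \<longleftrightarrow> 1 \<le> r \<and> 1 \<le> j \<and> r \<le> part (conj_partition lam) j"
    by (auto simp: diagram_def part_def split: if_splits)
  finally show ?thesis .
qed

lemma mem_diagram: "(r, j) \<in> diagram lam \<longleftrightarrow> 1 \<le> r \<and> 1 \<le> j \<and> j \<le> part lam r"
  by (auto simp: diagram_def part_def split: if_splits)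

lemma le_length_if_part_pos: "1 \<le> part nu j \<Longrightarrow> j \<le> length nu"
  by (auto simp: part_def split: if_splits)

lemma skew_diagram_cells:
  assumes "is_partition lam" "is_partition mu" "length (conj_partition lam) \<le> n"
  shows "skew_diagram lam mu = cells n (part (conj_partition mu)) (part (conj_partition lam))"
proof (rule Set.set_eqI)
  fix c :: "nat \<times> nat"
  obtain r j where c: "c = (r, j)" by force
  show "c \<in> skew_diagram lam mu \<longleftrightarrow> c \<in> cells n (part (conj_partition mu)) (part (conj_partition lam))"
    using le_length_if_part_pos[of "conj_partition lam" j] assms(3)
    by (auto simp: c skew_diagram_def mem_diagram_conj assms(1,2) cells_iff)
qed

lemma contained_iff_columns:
  assumes "is_partition lam" "is_partition mu" "length (conj_partition mu) \<le> n"
  shows "contained mu lam \<longleftrightarrow>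
    (\<forall>j. 1 \<le> j \<longrightarrow> j \<le> n \<longrightarrow> part (conj_partition mu) j \<le> part (conj_partition lam) j)"
proof -
  have "contained mu lam \<longleftrightarrow> diagram mu \<subseteq> diagram lam"
  proof
    assume "diagram mu \<subseteq> diagram lam"
    moreover have "(i, part mu i) \<in> diagram mu" if "1 \<le> i" "part mu i \<noteq> 0" for i
      using that by (auto simp: mem_diagram)
    ultimately show "contained mu lam"
      unfolding contained_def by (metis le0 mem_diagram subsetD)
  qed (auto simp: contained_def mem_diagram intro: order_trans)
  also have "\<dots> \<longleftrightarrow>
      (\<forall>j. 1 \<le> j \<longrightarrow> j \<le> n \<longrightarrow> part (conj_partition mu) j \<le> part (conj_partition lam) j)"
  proof safe
    fix j :: nat assume s: "diagram mu \<subseteq> diagram lam" and j: "1 \<le> j"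
    show "part (conj_partition mu) j \<le> part (conj_partition lam) j"
    proof (cases "part (conj_partition mu) j = 0")
      case False
      with j have "(part (conj_partition mu) j, j) \<in> diagram mu"
        by (simp add: mem_diagram_conj assms(2))
      with s show ?thesis using mem_diagram_conj[OF assms(1)] by blast
    qed simp
  next
    fix r j
    assume le: "\<forall>j. 1 \<le> j \<longrightarrow> j \<le> n \<longrightarrow> part (conj_partition mu) j \<le> part (conj_partition lam) j"
      and c: "(r, j) \<in> diagram mu"
    from c have "1 \<le> r" "1 \<le> j" "r \<le> part (conj_partition mu) j"
      by (auto simp: mem_diagram_conj assms(2))
    moreover from this have "j \<le> n"
      using le_length_if_part_pos[of "conj_partition mu" j] assms(3) by simp
    ultimately show "(r, j) \<in> diagram lam"
      using le by (auto simp: mem_diagram_conj assms(1) intro: order_trans)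
  qed
  finally show ?thesis .
qed

lemma decreasing_part: "is_partition nu \<Longrightarrow> decreasing n (part nu)"
  by (auto simp: decreasing_def intro: part_antimono)

definition dual_jt_entry :: "(nat \<Rightarrow> nat) \<Rightarrow> (nat \<Rightarrow> nat) \<Rightarrow> nat \<Rightarrow> nat \<Rightarrow> (gvar, int) mps" where
  "dual_jt_entry \<alpha> \<beta> i j = elem_sym (int (\<alpha> (Suc i)) - int (\<beta> (Suc j)) - int i + int j)
     ({X k | k. 1 \<le> k} \<union> {T k | k. \<beta> (Suc j) < k \<and> k < \<alpha> (Suc i)})"

text \<open>For \<open>\<beta>\<^sub>j < \<alpha>\<^sub>i\<close> the quotient of products in \<open>col_series\<close> is the product over the variables of
the elementary symmetric function. For \<open>\<alpha>\<^sub>i \<le> \<beta>\<^sub>j\<close> the two series can differ, but if \<open>j \<le> i\<close> then only a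
coefficient at an exponent \<open>\<le> 0\<close> is taken, and if \<open>i < j\<close> then the entry is irrelevant, since
\<open>\<alpha>\<^sub>r \<le> \<alpha>\<^sub>i \<le> \<beta>\<^sub>j \<le> \<beta>\<^sub>q\<close> makes the exponents negative in all rows \<open>r > i\<close> and columns \<open>q \<le> i\<close>.\<close>

lemma restrict_det_dual_jt:
  assumes "decreasing n \<alpha>" "decreasing n \<beta>"
  shows "mps_restrict (vars_upto N) (det (mat n n (\<lambda>(i, j). dual_jt_entry \<alpha> \<beta> i j))) =
    jt_det x_var t_var n N \<alpha> \<beta>"
proof -
  let ?e = "\<lambda>i j. fps_at ((\<Prod>k = 1..N. lin_factor (x_var k)) * (\<Prod>l\<in>{int (\<beta> (Suc j))<..<int (\<alpha> (Suc i))}. lin_factor (t_var l)))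
    (int (\<alpha> (Suc i)) - int (\<beta> (Suc j)) - int i + int j)"
  have entry: "mps_restrict (vars_upto N) (dual_jt_entry \<alpha> \<beta> i j) = ?e i j" for i j
  proof -
    let ?T = "{\<beta> (Suc j)<..<\<alpha> (Suc i)}"
    have V: "({X k | k. 1 \<le> k} \<union> {T k | k. \<beta> (Suc j) < k \<and> k < \<alpha> (Suc i)}) \<inter> vars_upto N =
        X ` {1..N} \<union> T ` ?T" by auto
    have "(\<Prod>v\<in>X ` {1..N} \<union> T ` ?T. lin_factor (mps_var v :: (gvar, int) mps)) =
        (\<Prod>v\<in>X ` {1..N}. lin_factor (mps_var v)) * (\<Prod>v\<in>T ` ?T. lin_factor (mps_var v))"
      by (rule prod.union_disjoint) auto
    also have "(\<Prod>v\<in>X ` {1..N}. lin_factor (mps_var v :: (gvar, int) mps)) = (\<Prod>k = 1..N. lin_factor (x_var k))"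
      by (subst prod.reindex) (auto simp: inj_on_def)
    also have "(\<Prod>v\<in>T ` ?T. lin_factor (mps_var v :: (gvar, int) mps)) =
        (\<Prod>l\<in>{int (\<beta> (Suc j))<..<int (\<alpha> (Suc i))}. lin_factor (t_var l))"
      by (rule prod.reindex_bij_witness[where i = "\<lambda>l. T (nat l)" and j = "\<lambda>v. case v of T l \<Rightarrow> int l | X l \<Rightarrow> int l"])
        (auto simp: zless_nat_eq_int_zless nat_less_iff)
    finally show ?thesis
      unfolding dual_jt_entry_def by (subst restrict_elem_sym; unfold V) simp_all
  qed
  interpret comm_ring_hom "mps_restrict (vars_upto N) :: (gvar, int) mps \<Rightarrow> _"
    by (rule mps_restrict_hom)
  have "mps_restrict (vars_upto N) (det (mat n n (\<lambda>(i, j). dual_jt_entry \<alpha> \<beta> i j))) =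
      det (mat n n (\<lambda>(i, j). ?e i j))"
    unfolding hom_det[symmetric]
    by (intro arg_cong[of _ _ det] eq_matI) (auto simp: entry)
  also have "\<dots> = jt_det x_var t_var n N \<alpha> \<beta>"
    unfolding jt_det_def
  proof (rule det_cong_irrelevant)
    fix i j assume ij: "i < n" "j < n"
    let ?E = "entry x_var t_var (- int n) N (\<lambda>j. int (\<beta> (Suc j)))"
    consider "\<beta> (Suc j) < \<alpha> (Suc i)" | "\<alpha> (Suc i) \<le> \<beta> (Suc j)" "j \<le> i" | "\<alpha> (Suc i) \<le> \<beta> (Suc j)" "i < j"
      by linarith
    then show "?e i j = ?E i (int (\<alpha> (Suc i))) j \<or>
      (i < j \<and> (\<forall>r q. i < r \<longrightarrow> r < n \<longrightarrow> q \<le> i \<longrightarrow> ?e r q = 0 \<and> ?E r (int (\<alpha> (Suc r))) q = 0))"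
    proof cases
      case 1
      then show ?thesis by (simp add: entry_def col_series_gt)
    next
      case 2
      then show ?thesis
        by (auto simp: entry_def fps_at_def col_series_nth_0 fps_nth_0_prod lin_factor_def)
    next
      case 3
      have "\<alpha> (Suc r) \<le> \<alpha> (Suc i)" "\<beta> (Suc j) \<le> \<beta> (Suc q)" if "i < r" "r < n" "q \<le> i" for r q
        using that 3 ij assms by (auto simp: decreasing_def)
      then have "int (\<alpha> (Suc r)) - int (\<beta> (Suc q)) - int r + int q < 0" if "i < r" "r < n" "q \<le> i" for r q
        using that 3(1) by fastforce
      then show ?thesis using 3(2) by (simp add: entry_def)
    qed
  qed
  finally show ?thesis .
qed

lemma det_dual_jt_not_contained:
  assumes "decreasing n \<alpha>" "decreasing n \<beta>" "1 \<le> k" "k \<le> n" "\<alpha> k < \<beta> k"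
  shows "det (mat n n (\<lambda>(i, j). dual_jt_entry \<alpha> \<beta> i j)) = 0"
proof (rule det_zero_block[of "{k - 1..<n}" n "{0..k - 1}"])
  fix i j assume ij: "i \<in> {k - 1..<n}" "j \<in> {0..k - 1}"
  then have "\<alpha> (Suc i) \<le> \<alpha> k" "\<beta> k \<le> \<beta> (Suc j)"
    using assms(1-4) by (auto simp: decreasing_def)
  with assms(5) ij show "dual_jt_entry \<alpha> \<beta> i j = 0" by (simp add: dual_jt_entry_def elem_sym_def)
qed (use assms(3,4) in auto)

text \<open>A monomial involves finitely many variables, hence it survives some restriction.\<close>

lemma mps_eqI_restrict:
  assumes "\<And>N. mps_restrict (vars_upto N) f = mps_restrict (vars_upto N) g"
  shows "f = g"
proof (rule mps_eqI)
  fix m :: "gvar multiset"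
  have fin: "finite (X -` set_mset m)" by (intro finite_vimageI) (auto simp: inj_def)
  have "set_mset m \<subseteq> vars_upto (Max (X -` set_mset m))"
  proof
    fix v assume "v \<in># m"
    then show "v \<in> vars_upto (Max (X -` set_mset m))"
      using fin by (cases v) (auto intro!: Max_ge)
  qed
  with assms[of "Max (X -` set_mset m)"] show "mps_nth f m = mps_nth g m"
    by (metis mps_nth_restrict)
qed

theorem theorem1p1:
  fixes lam mu :: "nat list" and n :: nat
  assumes "is_partition lam" and "is_partition mu"
    and "length (conj_partition lam) \<le> n" and "length (conj_partition mu) \<le> n"
  shows "dual_grothendieck lam mu =
    det (mat n n (\<lambda>(r, c). let i = r + 1; j = c + 1 in
      elem_sym
        (int (part (conj_partition lam) i) - int (part (conj_partition mu) j) - int i + int j)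
        ({X k | k. 1 \<le> k} \<union>
         {T k | k. part (conj_partition mu) j + 1 \<le> k \<and> int k \<le> int (part (conj_partition lam) i) - 1})))"
proof -
  define \<alpha> \<beta> where "\<alpha> = part (conj_partition lam)" and "\<beta> = part (conj_partition mu)"
  have dec: "decreasing n \<alpha>" "decreasing n \<beta>"
    unfolding \<alpha>_def \<beta>_def using conj_partition(1) assms(1,2) by (auto intro: decreasing_part)
  have lt: "int k \<le> int a - 1 \<longleftrightarrow> k < a" for k a by linarith
  have det: "(det (mat n n (\<lambda>(r, c). let i = r + 1; j = c + 1 in
      elem_sym
        (int (part (conj_partition lam) i) - int (part (conj_partition mu) j) - int i + int j)
        ({X k | k. 1 \<le> k} \<union>
         {T k | k. part (conj_partition mu) j + 1 \<le> k \<and> int k \<le> int (part (conj_partition lam) i) - 1}))))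
      = det (mat n n (\<lambda>(i, j). dual_jt_entry \<alpha> \<beta> i j))"
    by (intro arg_cong[of _ _ det] cong_mat)
      (auto simp: dual_jt_entry_def \<alpha>_def \<beta>_def Let_def Suc_le_eq lt intro!: arg_cong2[of _ _ _ _ elem_sym])
  show ?thesis
  proof (cases "contained mu lam")
    case True
    then have le: "\<beta> j \<le> \<alpha> j" if "1 \<le> j" "j \<le> n" for j
      using that contained_iff_columns[OF assms(1,2,4)] by (simp add: \<alpha>_def \<beta>_def)
    have D: "skew_diagram lam mu = cells n \<beta> \<alpha>"
      unfolding \<alpha>_def \<beta>_def by (rule skew_diagram_cells[OF assms(1-3)])
    have "mps_restrict (vars_upto N) (dual_grothendieck lam mu) =
        mps_restrict (vars_upto N) (det (mat n n (\<lambda>(i, j). dual_jt_entry \<alpha> \<beta> i j)))" for N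
      using True
      by (simp add: dual_grothendieck_def restrict_rpp_sum[OF D] restrict_det_dual_jt[OF dec]
          rpp_sum_eq_jt_det[OF dec le])
    then show ?thesis unfolding det by (rule mps_eqI_restrict)
  next
    case False
    then obtain k where "1 \<le> k" "k \<le> n" "\<alpha> k < \<beta> k"
      using contained_iff_columns[OF assms(1,2,4)] by (auto simp: \<alpha>_def \<beta>_def not_le)
    then have "det (mat n n (\<lambda>(i, j). dual_jt_entry \<alpha> \<beta> i j)) = 0"
      by (rule det_dual_jt_not_contained[OF dec])
    with False show ?thesis unfolding det by (simp add: dual_grothendieck_def)
  qed
qed

end
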